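(* The operators $\partial_E$ and $\partial_H$ on the graph complex $\mathcal G$ anticommute: $\partial_E\partial_H=-\partial_H\partial_E$.
   Context: Graphs. A graph is a finite 1-dimensional CW complex (not necessarily connected, multiple edges allowed) all of whose vertices have valence at least 3. A labelling of a graph is a numbering $1,2,\dots$ of its vertices together with an arrow on each edge. An orientation is an equivalence class of labellings: reversing the arrow on one edge, or switching the numbers of two vertices, changes the orientation to the opposite one. $\mathcal G$ is the vector space, over a fixed field of characteristic zero, of linear combinations of (isomorphism classes of) oriented graphs modulo $(X,or)=-(X,-or)$; it is graded by the number of vertices. A graph with a loop (an edge with equal endpoints) is zero in $\mathcal G$, so graphs may be assumed loopless. The orientation is suppressed from the notation. Collapse. For a (non-loop) edge $e$ of $X$, $X_e$ is obtained by collapsing $e$ to a point. Induced orientation: represent the orientation of $X$ by a labelling in which the initial vertex of $e$ is 1 and the terminal vertex is 2; in $X_e$ the vertex resulting from the collapse is numbered 1, the numbers of all other vertices are reduced by one, and arrows on uncontracted edges are unchanged. Half-edges. Each half-edge $h$ begins at a vertex $v(h)$, lies in an edge $e(h)$, and has a complementary half-edge $\bar h$ with $e(h)=h\cup\bar h$. For distinct half-edges $h,k$ with $k\ne\bar h$, $X\langle hk\rangle$ is obtained by cutting $e(h)$ and $e(k)$ at their midpoints and gluing $h$ to $k$ and $\bar h$ to $\bar k$; orientation: represent the orientation of $X$ so that $h$ is the initial half-edge of $e(h)$ and $k$ is the terminal half-edge of $e(k)$; in $X\langle hk\rangle$ the edge $h\cup k$ is directed from $h$ to $k$ and the edge $\bar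 h\cup\bar k$ from $\bar k$ to $\bar h$, all else unchanged. If $v(h)\ne v(k)$, $X_{hk}:=(X\langle hk\rangle)_{h\cup k}$; if $v(h)=v(k)$, $X_{hk}:=0$. One has $X_{hk}=X_{kh}$. Operators (extended linearly): $\partial_E X=\sum_e X_e$, sum over all edges $e$ of $X$; $\partial_H X=\sum X_{hk}$, sum over all unordered pairs $\{h,k\}$ of distinct half-edges of $X$ with $k\neq\bar h$. *)

theory Defs
  imports Complex_Main "HOL-Library.Poly_Mapping"
begin

section \<open>Graphs and orientations\<close>

text \<open>
  A graph is given by its vertices, its half-edges, the fixed-point-free involution
  \<open>bar\<close> taking a half-edge to its complement in the same edge, and the map \<open>vert\<close> giving the
  vertex at which a half-edge begins.  Every finite graph has an isomorphic copy whose vertices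
  and half-edges are natural numbers; values of \<open>bar\<close> and \<open>vert\<close> off \<open>halves\<close> are irrelevant.
  Loops, multiple edges, disconnected graphs and the empty graph are allowed.
\<close>

record pregraph =
  verts :: "nat set"
  halves :: "nat set"
  bar :: "nat \<Rightarrow> nat"
  vert :: "nat \<Rightarrow> nat"

definition graph :: "pregraph \<Rightarrow> bool" where
  "graph X \<longleftrightarrow> finite (verts X) \<and> finite (halves X) \<and>
     (\<forall>h\<in>halves X. vert X h \<in> verts X \<and> bar X h \<in> halves X \<and> bar X h \<noteq> h \<and> bar X (bar X h) = h) \<and>
     (\<forall>v\<in>verts X. 3 \<le> card {h \<in> halves X. vert X h = v})"

definition edges :: "pregraph \<Rightarrow> nat set set" where
  "edges X = {{h, bar X h} | h. h \<in> halves X}"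

definition is_loop :: "pregraph \<Rightarrow> nat set \<Rightarrow> bool" where
  "is_loop X e \<longleftrightarrow> is_singleton (vert X ` e)"

text \<open>
  In a labelling \<open>(vs, A)\<close>, the list \<open>vs\<close> enumerates the vertices (its first entry is vertex
  number 1, its second entry vertex number 2, and so on), and \<open>A\<close> is the set of initial
  half-edges: an arrow on an edge is the choice of one of its two half-edges as initial.
\<close>

type_synonym labelling = "nat list \<times> nat set"

definition labellings :: "pregraph \<Rightarrow> labelling set" where
  "labellings X = {(vs, A). distinct vs \<and> set vs = verts X \<and> A \<subseteq> halves X \<and>
     (\<forall>h\<in>halves X. h \<in> A \<longleftrightarrow> bar X h \<notin> A)}"

text \<open>
  A single move switches the numbers of two vertices or reverses one arrow.  Labellings related
  by an even number of moves define the same orientation, those related by one move define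
  opposite orientations.
\<close>

definition moves :: "pregraph \<Rightarrow> (labelling \<times> labelling) set" where
  "moves X = {((vs, A), (ws, B)). (vs, A) \<in> labellings X \<and>
     ((\<exists>i j. i < j \<and> j < length vs \<and> ws = vs[i := vs ! j, j := vs ! i] \<and> B = A) \<or>
      (\<exists>h\<in>A. ws = vs \<and> B = insert (bar X h) (A - {h})))}"

definition same_orientation :: "pregraph \<Rightarrow> (labelling \<times> labelling) set" where
  "same_orientation X = {(l, m). l \<in> labellings X \<and> (l, m) \<in> (moves X O moves X)\<^sup>*}"

definition orientations :: "pregraph \<Rightarrow> labelling set set" where
  "orientations X = labellings X // same_orientation X"

definition opposite :: "pregraph \<Rightarrow> labelling set \<Rightarrow> labelling set \<Rightarrow> bool" where
  "opposite X \<omega> \<omega>' \<longleftrightarrow> \<omega> \<in> orientations X \<and> \<omega>' \<in> orientations X \<and>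
     (\<exists>l\<in>\<omega>. \<exists>m\<in>\<omega>'. (l, m) \<in> moves X)"

typedef oriented_graph = "{(X, \<omega>). graph X \<and> \<omega> \<in> orientations X}"
  morphisms rep_oriented Oriented
proof -
  let ?X = "\<lparr>verts = {}, halves = {}, bar = id, vert = id\<rparr>"
  have "graph ?X" by (simp add: graph_def)
  moreover have "([], {}) \<in> labellings ?X" by (simp add: labellings_def)
  ultimately show ?thesis by (auto simp: orientations_def intro!: exI[of _ ?X] quotientI)
qed

abbreviation graph_of :: "oriented_graph \<Rightarrow> pregraph" where
  "graph_of G \<equiv> fst (rep_oriented G)"

abbreviation orientation_of :: "oriented_graph \<Rightarrow> labelling set" where
  "orientation_of G \<equiv> snd (rep_oriented G)"

text \<open>
  Isomorphisms act on half-edges, so an isomorphism may fix an edge and exchange its two halves.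
\<close>

definition graph_iso :: "pregraph \<Rightarrow> pregraph \<Rightarrow> (nat \<Rightarrow> nat) \<Rightarrow> (nat \<Rightarrow> nat) \<Rightarrow> bool" where
  "graph_iso X Y f g \<longleftrightarrow> bij_betw f (verts X) (verts Y) \<and> bij_betw g (halves X) (halves Y) \<and>
     (\<forall>h\<in>halves X. bar Y (g h) = g (bar X h) \<and> vert Y (g h) = f (vert X h))"

definition transport :: "(nat \<Rightarrow> nat) \<Rightarrow> (nat \<Rightarrow> nat) \<Rightarrow> labelling \<Rightarrow> labelling" where
  "transport f g = (\<lambda>(vs, A). (map f vs, g ` A))"

definition isomorphic :: "oriented_graph \<Rightarrow> oriented_graph \<Rightarrow> bool" where
  "isomorphic G G' \<longleftrightarrow> (\<exists>f g. graph_iso (graph_of G) (graph_of G') f g \<and>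
     transport f g ` orientation_of G = orientation_of G')"

definition opposite_oriented :: "oriented_graph \<Rightarrow> oriented_graph \<Rightarrow> bool" where
  "opposite_oriented G G' \<longleftrightarrow> graph_of G = graph_of G' \<and> opposite (graph_of G) (orientation_of G) (orientation_of G')"

section \<open>Collapsing, cutting and gluing\<close>

text \<open>
  An edge is the two-element set of its half-edges.  The vertex obtained by collapsing a non-loop
  edge is named after the smaller of its two end points; only the isomorphism class matters.
\<close>

definition collapse :: "pregraph \<Rightarrow> nat set \<Rightarrow> pregraph" where
  "collapse X e = \<lparr>verts = verts X - vert X ` e \<union> {Min (vert X ` e)},
     halves = halves X - e, bar = bar X,
     vert = (\<lambda>k. if vert X k \<in> vert X ` e then Min (vert X ` e) else vert X k)\<rparr>"

text \<open>
  The orientation of the collapsed graph is represented by collapsing any labelling of the given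
  orientation in which the collapsed edge runs from vertex 1 to vertex 2: the merged vertex gets
  number 1 and all other numbers drop by one, which on lists means replacing the first two entries
  by one.
\<close>

definition collapse_orientation :: "pregraph \<Rightarrow> labelling set \<Rightarrow> nat set \<Rightarrow> labelling set" where
  "collapse_orientation X \<omega> e = {m. \<exists>h vs A. h \<in> e \<and> h \<in> A \<and>
     (vert X h # vert X (bar X h) # vs, A) \<in> \<omega> \<and>
     ((Min (vert X ` e) # vs, A - e), m) \<in> same_orientation (collapse X e)}"

text \<open>
  \<open>cut_glue X h k\<close> is the graph X<hk>, for half-edges \<open>h \<noteq> k\<close> with \<open>k \<noteq> bar X h\<close>.
\<close>

definition cut_glue :: "pregraph \<Rightarrow> nat \<Rightarrow> nat \<Rightarrow> pregraph" where
  "cut_glue X h k =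
     X\<lparr>bar := (bar X)(h := k, k := h, bar X h := bar X k, bar X k := bar X h)\<rparr>"

text \<open>
  The representing labelling has \<open>h\<close> initial and \<open>k\<close> terminal, so that \<open>bar X h\<close> is terminal and
  \<open>bar X k\<close> is initial.  In the new graph the edge \<open>{h, k}\<close> is directed from \<open>h\<close> to \<open>k\<close> and the other
  new edge from \<open>bar X k\<close> to \<open>bar X h\<close>, so the set of initial half-edges does not change.
\<close>

definition cut_glue_orientation :: "pregraph \<Rightarrow> labelling set \<Rightarrow> nat \<Rightarrow> nat \<Rightarrow> labelling set" where
  "cut_glue_orientation X \<omega> h k = {m. \<exists>vs A. (vs, A) \<in> \<omega> \<and> h \<in> A \<and> k \<notin> A \<and>
     ((vs, A), m) \<in> same_orientation (cut_glue X h k)}"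

definition collapse_edge :: "oriented_graph \<Rightarrow> nat set \<Rightarrow> oriented_graph" where
  "collapse_edge G e =
     Oriented (collapse (graph_of G) e, collapse_orientation (graph_of G) (orientation_of G) e)"

definition half_edge_pairs :: "pregraph \<Rightarrow> nat set set" where
  "half_edge_pairs X = {{h, k} | h k. h \<in> halves X \<and> k \<in> halves X \<and> h \<noteq> k \<and> k \<noteq> bar X h}"

definition cut_glue_oriented :: "oriented_graph \<Rightarrow> nat \<Rightarrow> nat \<Rightarrow> oriented_graph" where
  "cut_glue_oriented G h k =
     Oriented (cut_glue (graph_of G) h k, cut_glue_orientation (graph_of G) (orientation_of G) h k)"

section \<open>The graph complex\<close>

definition chain_scale :: "'k::field \<Rightarrow> ('a \<Rightarrow>\<^sub>0 'k) \<Rightarrow> ('a \<Rightarrow>\<^sub>0 'k)" where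
  "chain_scale c = Poly_Mapping.map ((*) c)"

lemma lookup_chain_scale [simp]: "Poly_Mapping.lookup (chain_scale c p) x = c * Poly_Mapping.lookup p x"
  by (simp add: chain_scale_def map.rep_eq when_def)

interpretation chain: vector_space "chain_scale :: 'k::field \<Rightarrow> ('a \<Rightarrow>\<^sub>0 'k) \<Rightarrow> _"
  by unfold_locales (auto intro!: poly_mapping_eqI simp: lookup_add algebra_simps)

text \<open>
  The graph complex is the free vector space on oriented graphs modulo the relations
  (X,or) = (Y,or') for isomorphic oriented graphs and (X,or) = -(X,-or).
\<close>

definition relations :: "(oriented_graph \<Rightarrow>\<^sub>0 'k::field_char_0) set" where
  "relations =
     {Poly_Mapping.single G 1 - Poly_Mapping.single G' 1 | G G'. isomorphic G G'} \<union>
     {Poly_Mapping.single G 1 + Poly_Mapping.single G' 1 | G G'. opposite_oriented G G'}"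

definition gc_equiv :: "(oriented_graph \<Rightarrow>\<^sub>0 'k::field_char_0) \<Rightarrow> (oriented_graph \<Rightarrow>\<^sub>0 'k) \<Rightarrow> bool" where
  "gc_equiv c d \<longleftrightarrow> c - d \<in> chain.span relations"

quotient_type (overloaded) 'k graph_complex = "oriented_graph \<Rightarrow>\<^sub>0 ('k::field_char_0)" / gc_equiv
proof (rule equivpI)
  show "reflp (gc_equiv :: (_ \<Rightarrow>\<^sub>0 'k) \<Rightarrow> _)" by (auto simp: reflp_def gc_equiv_def chain.span_zero)
  show "symp (gc_equiv :: (_ \<Rightarrow>\<^sub>0 'k) \<Rightarrow> _)" using chain.span_neg by (fastforce simp: symp_def gc_equiv_def)
  show "transp (gc_equiv :: (_ \<Rightarrow>\<^sub>0 'k) \<Rightarrow> _)" unfolding transp_def gc_equiv_def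
  proof (intro allI impI)
    fix x y z :: "oriented_graph \<Rightarrow>\<^sub>0 'k"
    assume "x - y \<in> chain.span relations" "y - z \<in> chain.span relations"
    from chain.span_add[OF this] show "x - z \<in> chain.span relations" by simp
  qed
qed

instantiation graph_complex :: (field_char_0) ab_group_add
begin

lift_definition zero_graph_complex :: "'a graph_complex" is 0 .

lift_definition plus_graph_complex :: "'a graph_complex \<Rightarrow> 'a graph_complex \<Rightarrow> 'a graph_complex" is "(+)"
  unfolding gc_equiv_def
proof -
  fix a b c d :: "oriented_graph \<Rightarrow>\<^sub>0 'a"
  assume "a - b \<in> chain.span relations" "c - d \<in> chain.span relations"
  from chain.span_add[OF this] show "(a + c) - (b + d) \<in> chain.span relations" by (simp add: algebra_simps)
qed

lift_definition uminus_graph_complex :: "'a graph_complex \<Rightarrow> 'a graph_complex" is uminus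
  unfolding gc_equiv_def
proof -
  fix a b :: "oriented_graph \<Rightarrow>\<^sub>0 'a"
  assume "a - b \<in> chain.span relations"
  from chain.span_neg[OF this] show "- a - - b \<in> chain.span relations" by simp
qed

lift_definition minus_graph_complex :: "'a graph_complex \<Rightarrow> 'a graph_complex \<Rightarrow> 'a graph_complex" is "(-)"
  unfolding gc_equiv_def
proof -
  fix a b c d :: "oriented_graph \<Rightarrow>\<^sub>0 'a"
  assume "a - b \<in> chain.span relations" "c - d \<in> chain.span relations"
  from chain.span_diff[OF this] show "(a - c) - (b - d) \<in> chain.span relations" by (simp add: algebra_simps)
qed

instance
  by standard (transfer, simp add: gc_equiv_def chain.span_zero algebra_simps)+

end

lift_definition gc_scale :: "'k::field_char_0 \<Rightarrow> 'k graph_complex \<Rightarrow> 'k graph_complex" is chain_scale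
  unfolding gc_equiv_def by (metis chain.scale_right_diff_distrib chain.span_scale)

interpretation gc: vector_space "gc_scale :: 'k::field_char_0 \<Rightarrow> _"
  by unfold_locales (transfer, simp add: gc_equiv_def chain.span_zero chain.scale_right_distrib chain.scale_left_distrib)+

lift_definition gc_class :: "oriented_graph \<Rightarrow> 'k::field_char_0 graph_complex"
  is "\<lambda>G. Poly_Mapping.single G 1" .

section \<open>The operators on generators\<close>

definition linear_extension ::
    "(oriented_graph \<Rightarrow> (oriented_graph \<Rightarrow>\<^sub>0 'k::field_char_0)) \<Rightarrow> (oriented_graph \<Rightarrow>\<^sub>0 'k) \<Rightarrow> (oriented_graph \<Rightarrow>\<^sub>0 'k)" where
  "linear_extension \<phi> c = (\<Sum>G\<in>Poly_Mapping.keys c. chain_scale (Poly_Mapping.lookup c G) (\<phi> G))"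

text \<open>
  A loop contributes nothing to the sum over edges: a graph with a loop is zero in the graph
  complex (lemma \<open>gc_class_loop\<close> below), and so is each of its collapses.
\<close>

definition collapse_term :: "oriented_graph \<Rightarrow> nat set \<Rightarrow> (oriented_graph \<Rightarrow>\<^sub>0 'k::field_char_0)" where
  "collapse_term G e =
     (if is_loop (graph_of G) e then 0 else Poly_Mapping.single (collapse_edge G e) 1)"

definition pinch_term :: "oriented_graph \<Rightarrow> nat \<Rightarrow> nat \<Rightarrow> (oriented_graph \<Rightarrow>\<^sub>0 'k::field_char_0)" where
  "pinch_term G h k =
     (if vert (graph_of G) h = vert (graph_of G) k then 0
      else Poly_Mapping.single (collapse_edge (cut_glue_oriented G h k) {h, k}) 1)"

definition boundary_E_gen :: "oriented_graph \<Rightarrow> (oriented_graph \<Rightarrow>\<^sub>0 'k::field_char_0)" where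
  "boundary_E_gen G = (\<Sum>e\<in>edges (graph_of G). collapse_term G e)"

text \<open>
  The order in which an unordered pair of half-edges is listed does not matter, see
  \<open>pinch_term_commute\<close> below.
\<close>

definition boundary_H_gen :: "oriented_graph \<Rightarrow> (oriented_graph \<Rightarrow>\<^sub>0 'k::field_char_0)" where
  "boundary_H_gen G = (\<Sum>p\<in>half_edge_pairs (graph_of G). pinch_term G (Min p) (Max p))"

section \<open>The operators are well defined\<close>

subsection \<open>Orientations in terms of signs\<close>

fun lsign :: "nat list \<Rightarrow> int" where
  "lsign [] = 1"
| "lsign (x # xs) = (\<Prod>y\<leftarrow>xs. if y < x then -1 else 1) * lsign xs"

fun par :: "pregraph \<Rightarrow> labelling \<Rightarrow> int" where
  "par X (vs, A) = lsign vs * (\<Prod>h\<in>A. if bar X h < h then -1 else 1)"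

lemma lsign_swap_adjacent:
  "x \<noteq> y \<Longrightarrow> lsign (as @ x # y # cs) = - lsign (as @ y # x # cs)"
proof (induction as)
  case (Cons a as)
  have "(\<Prod>z\<leftarrow>as @ x # y # cs. if z < a then -1 else (1::int)) =
      (\<Prod>z\<leftarrow>as @ y # x # cs. if z < a then -1 else 1)"
    by (simp only: map_append list.map prod_list.append prod_list.Cons mult.left_commute)
  with Cons.IH[OF Cons.prems] show ?case
    by (simp only: append_Cons lsign.simps mult_minus_right)
qed auto

lemma lsign_swap_append:
  "distinct (as @ x # bs @ y # cs) \<Longrightarrow> lsign (as @ x # bs @ y # cs) = - lsign (as @ y # bs @ x # cs)"
proof (induction bs arbitrary: as)
  case Nil
  then show ?case using lsign_swap_adjacent[of x y as cs] by simp
next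
  case (Cons b bs)
  have "lsign (as @ x # (b # bs) @ y # cs) = - lsign ((as @ [b]) @ x # bs @ y # cs)"
    using lsign_swap_adjacent[of x b as "bs @ y # cs"] Cons.prems by auto
  also have "\<dots> = lsign ((as @ [b]) @ y # bs @ x # cs)"
    by (subst Cons.IH) (use Cons.prems in auto)
  also have "\<dots> = - lsign (as @ y # (b # bs) @ x # cs)"
    using lsign_swap_adjacent[of b y as "bs @ x # cs"] Cons.prems by auto
  finally show ?case .
qed

lemma swap_decomp:
  assumes "i < j" "j < length vs"
  obtains as bs cs where "vs = as @ vs ! i # bs @ vs ! j # cs"
    "vs[i := vs ! j, j := vs ! i] = as @ vs ! j # bs @ vs ! i # cs"
proof -
  define as where "as = take i vs"
  define r where "r = drop (Suc i) vs"
  have 1: "vs = as @ vs ! i # r" unfolding as_def r_def using assms by (simp add: id_take_nth_drop)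
  define k where "k = j - Suc i"
  have k: "k < length r" "r ! k = vs ! j" using assms unfolding k_def r_def by auto
  have 2: "r = take k r @ vs ! j # drop (Suc k) r" using k id_take_nth_drop by metis
  have la: "length as = i" using assms by (simp add: as_def)
  have jk: "j = Suc (i + k)" using assms k_def by simp
  show thesis
  proof (rule that[of as "take k r" "drop (Suc k) r"])
    show "vs = as @ vs ! i # take k r @ vs ! j # drop (Suc k) r" using 1 2 by metis
    have "vs[i := vs ! j, j := vs ! i] = (as @ vs ! i # r)[i := vs ! j, j := vs ! i]"
      using 1 by simp
    also have "\<dots> = as @ vs ! j # (r[k := vs ! i])"
      using la jk by (simp add: list_update_append)
    also have "r[k := vs ! i] = take k r @ vs ! i # drop (Suc k) r"
      using k(1) upd_conv_take_nth_drop by metis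
    finally show "vs[i := vs ! j, j := vs ! i] = as @ vs ! j # take k r @ vs ! i # drop (Suc k) r" .
  qed
qed

lemma lsign_swap:
  assumes "i < j" "j < length vs" "distinct vs"
  shows "lsign (vs[i := vs ! j, j := vs ! i]) = - lsign vs"
proof -
  obtain as bs cs where *: "vs = as @ vs ! i # bs @ vs ! j # cs"
    "vs[i := vs ! j, j := vs ! i] = as @ vs ! j # bs @ vs ! i # cs"
    using swap_decomp[OF assms(1,2)] by blast
  have "distinct (as @ vs ! i # bs @ vs ! j # cs)" using * assms(3) by metis
  from lsign_swap_append[OF this]
  show ?thesis using arg_cong[OF *(1), of lsign] arg_cong[OF *(2), of lsign] by linarith
qed

lemma lsign_pm: "lsign vs = 1 \<or> lsign vs = -1"
proof (induction vs)
  case (Cons x xs)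
  have "(\<Prod>y\<leftarrow>xs. if y < x then -1 else 1) = (1::int) \<or> (\<Prod>y\<leftarrow>xs. if y < x then -1 else 1) = (-1::int)"
    by (induction xs) auto
  then show ?case using Cons by auto
qed auto

lemma par_pm: "par X l = 1 \<or> par X l = -1"
proof (cases l)
  case (Pair vs A)
  have "(\<Prod>h\<in>A. if bar X h < h then -1 else 1) = (1::int) \<or> (\<Prod>h\<in>A. if bar X h < h then -1 else 1) = (-1::int)"
    by (induction A rule: infinite_finite_induct) auto
  then show ?thesis using Pair lsign_pm[of vs] by auto
qed

lemma labD:
  assumes "(vs, A) \<in> labellings X" shows "distinct vs" "set vs = verts X" "A \<subseteq> halves X"
   "h \<in> halves X \<Longrightarrow> h \<in> A \<longleftrightarrow> bar X h \<notin> A"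
  using assms by (auto simp: labellings_def)

lemma graphD:
  assumes "graph X" shows "finite (verts X)" "finite (halves X)"
   "h \<in> halves X \<Longrightarrow> vert X h \<in> verts X" "h \<in> halves X \<Longrightarrow> bar X h \<in> halves X"
   "h \<in> halves X \<Longrightarrow> bar X h \<noteq> h" "h \<in> halves X \<Longrightarrow> bar X (bar X h) = h"
   "v \<in> verts X \<Longrightarrow> 3 \<le> card {h \<in> halves X. vert X h = v}"
  using assms by (auto simp: graph_def)

lemma flip_labelling:
  assumes X: "graph X" and l: "(vs, A) \<in> labellings X" and h: "h \<in> A"
  shows "(vs, insert (bar X h) (A - {h})) \<in> labellings X"
proof -
  note G = graphD(4-6)[OF X]
  have hH: "h \<in> halves X" using l h by (auto simp: labellings_def)
  have bA: "bar X h \<notin> A" using labD(4)[OF l hH] h by simp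
  have "k \<in> insert (bar X h) (A - {h}) \<longleftrightarrow> bar X k \<notin> insert (bar X h) (A - {h})"
    if k: "k \<in> halves X" for k
  proof (cases "k = h \<or> k = bar X h")
    case False
    then have "bar X k \<noteq> h" "bar X k \<noteq> bar X h" using G[OF k] G[OF hH] by metis+
    then show ?thesis using False labD(4)[OF l k] by auto
  qed (use G[OF hH] bA h in auto)
  then show ?thesis using l G(1)[OF hH] unfolding labellings_def by auto
qed

lemma swap_labelling:
  assumes "(vs, A) \<in> labellings X" "i < j" "j < length vs"
  shows "(vs[i := vs ! j, j := vs ! i], A) \<in> labellings X"
  using assms by (auto simp: labellings_def set_swap distinct_swap)

lemma moves_labelling: "graph X \<Longrightarrow> (l, m) \<in> moves X \<Longrightarrow> l \<in> labellings X \<and> m \<in> labellings X"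
  by (auto simp: moves_def flip_labelling swap_labelling)

lemma moves_swapI:
  "(vs, A) \<in> labellings X \<Longrightarrow> i < j \<Longrightarrow> j < length vs \<Longrightarrow> ((vs, A), (vs[i := vs ! j, j := vs ! i], A)) \<in> moves X"
  by (auto simp: moves_def)

lemma moves_flipI:
  "(vs, A) \<in> labellings X \<Longrightarrow> h \<in> A \<Longrightarrow> ((vs, A), (vs, insert (bar X h) (A - {h}))) \<in> moves X"
  by (auto simp: moves_def)

lemma moves_par:
  assumes X: "graph X" and "(l, m) \<in> moves X" shows "par X m = - par X l"
proof -
  obtain vs A ws B where lm: "l = (vs, A)" "m = (ws, B)" by (meson surj_pair)
  have l: "(vs, A) \<in> labellings X" using assms lm by (auto simp: moves_def)
  consider (s) i j where "i < j" "j < length vs" "ws = vs[i := vs ! j, j := vs ! i]" "B = A"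
    | (f) h where "h \<in> A" "ws = vs" "B = insert (bar X h) (A - {h})"
    using assms lm by (auto simp: moves_def)
  then show ?thesis
  proof cases
    case s
    then show ?thesis using lsign_swap[of i j vs] l lm by (simp add: labellings_def)
  next
    case f
    have fA: "finite A" using l graphD[OF X] finite_subset by (auto simp: labellings_def)
    have hH: "h \<in> halves X" using l f by (auto simp: labellings_def)
    have bA: "bar X h \<notin> A" using labD(4)[OF l hH] f by simp
    have "(\<Prod>h\<in>A. if bar X h < h then -1 else 1) =
       (if bar X h < h then -1 else (1::int)) * (\<Prod>h\<in>A - {h}. if bar X h < h then -1 else 1)"
      using fA f(1) by (subst prod.remove) auto
    moreover have "(\<Prod>h\<in>B. if bar X h < h then -1 else 1) =
       (if h < bar X h then -1 else (1::int)) * (\<Prod>h\<in>A - {h}. if bar X h < h then -1 else 1)"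
      unfolding f(3) using fA bA graphD(6)[OF X hH] by (subst prod.insert) auto
    ultimately show ?thesis using lm f(2) graphD(5)[OF X hH] by auto
  qed
qed

lemma moves_sym:
  assumes X: "graph X" and "(l, m) \<in> moves X" shows "(m, l) \<in> moves X"
proof -
  obtain vs A ws B where lm: "l = (vs, A)" "m = (ws, B)" by (meson surj_pair)
  have l: "(vs, A) \<in> labellings X" using assms lm by (auto simp: moves_def)
  have m: "(ws, B) \<in> labellings X" using moves_labelling assms lm by auto
  consider (s) i j where "i < j" "j < length vs" "ws = vs[i := vs ! j, j := vs ! i]" "B = A"
    | (f) h where "h \<in> A" "ws = vs" "B = insert (bar X h) (A - {h})"
    using assms lm by (auto simp: moves_def)
  then show ?thesis
  proof cases
    case s
    have "vs = ws[i := ws ! j, j := ws ! i]" unfolding s(3) using s(1,2)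
      by (auto intro!: nth_equalityI simp: nth_list_update)
    then show ?thesis using moves_swapI[OF m, of i j] s lm by simp
  next
    case f
    have hH: "h \<in> halves X" using l f by (auto simp: labellings_def)
    have bA: "bar X h \<notin> A" using labD(4)[OF l hH] f by simp
    have "A = insert (bar X (bar X h)) (B - {bar X h})"
      unfolding f(3) graphD(6)[OF X hH] using bA f(1) graphD(5)[OF X hH] by auto
    then show ?thesis using moves_flipI[OF m, of "bar X h"] f lm by simp
  qed
qed

lemma perm_connected:
  assumes X: "graph X"
  shows "distinct (zs @ xs) \<Longrightarrow> distinct ys \<Longrightarrow> set xs = set ys \<Longrightarrow> (zs @ xs, A) \<in> labellings X \<Longrightarrow>
   ((zs @ ys, A), (zs @ xs, A)) \<in> (moves X)\<^sup>*"
proof (induction xs arbitrary: zs ys)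
  case Nil
  then show ?case by simp
next
  case (Cons x xs)
  have lab: "(zs @ ws, A) \<in> labellings X" if "distinct ws" "set ws = set (x # xs)" for ws
    using Cons.prems that by (auto simp: labellings_def)
  have "x \<in> set ys" using Cons.prems by auto
  then obtain bs cs where ys: "ys = bs @ x # cs" by (meson split_list)
  have "\<exists>ws. distinct (x # ws) \<and> set (x # ws) = set (x # xs) \<and> ((zs @ ys, A), (zs @ x # ws, A)) \<in> (moves X)\<^sup>*"
  proof (cases bs)
    case Nil
    then show ?thesis using ys Cons.prems by (intro exI[of _ cs]) auto
  next
    case (Cons b bs')
    let ?v = "zs @ ys" and ?i = "length zs" and ?j = "length zs + length bs"
    have "(?v, A) \<in> labellings X" using lab Cons.prems by auto
    from moves_swapI[OF this, of ?i ?j]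
    have "((?v, A), (?v[?i := ?v ! ?j, ?j := ?v ! ?i], A)) \<in> moves X"
      using ys Cons by simp
    moreover have "?v[?i := ?v ! ?j, ?j := ?v ! ?i] = zs @ x # bs' @ b # cs"
      using ys Cons by (simp add: nth_append list_update_append)
    ultimately show ?thesis using Cons.prems ys Cons
      by (intro exI[of _ "bs' @ b # cs"]) auto
  qed
  then obtain ws where ws: "distinct (x # ws)" "set (x # ws) = set (x # xs)"
    "((zs @ ys, A), (zs @ x # ws, A)) \<in> (moves X)\<^sup>*" by blast
  have "set xs = set ws" using ws Cons.prems by auto
  then have "(((zs @ [x]) @ ws, A), ((zs @ [x]) @ xs, A)) \<in> (moves X)\<^sup>*"
    using Cons.prems ws by (intro Cons.IH) auto
  then show ?case using ws(3) by simp
qed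

lemma arrows_connected:
  assumes X: "graph X"
  shows "card (A - B) = n \<Longrightarrow> (vs, A) \<in> labellings X \<Longrightarrow> (vs, B) \<in> labellings X \<Longrightarrow>
   ((vs, A), (vs, B)) \<in> (moves X)\<^sup>*"
proof (induction n arbitrary: A)
  case 0
  have "finite A" using 0 graphD[OF X] finite_subset by (auto simp: labellings_def)
  then have AB: "A \<subseteq> B" using 0 by auto
  have "B \<subseteq> A"
  proof
    fix h assume "h \<in> B"
    then have "h \<in> halves X" "bar X h \<notin> B" using 0 by (auto simp: labellings_def)
    then show "h \<in> A" using AB 0(2) by (auto simp: labellings_def)
  qed
  then show ?case using AB by simp
next
  case (Suc n)
  have fA: "finite A" using Suc.prems graphD[OF X] finite_subset by (auto simp: labellings_def)
  obtain h where h: "h \<in> A" "h \<notin> B" using Suc.prems by (metis card.empty Diff_iff all_not_in_conv nat.simps(3))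
  have hH: "h \<in> halves X" using Suc.prems h by (auto simp: labellings_def)
  have "bar X h \<in> B" using labD(4)[OF Suc.prems(3) hH] h by simp
  then have "insert (bar X h) (A - {h}) - B = (A - B) - {h}" by auto
  then have "card (insert (bar X h) (A - {h}) - B) = n" using Suc.prems(1) h fA by simp
  from Suc.IH[OF this flip_labelling[OF X Suc.prems(2) h(1)] Suc.prems(3)]
  show ?case using moves_flipI[OF Suc.prems(2) h(1)] by (meson converse_rtrancl_into_rtrancl)
qed

lemma moves_connected:
  assumes X: "graph X" and "l \<in> labellings X" "m \<in> labellings X"
  shows "(l, m) \<in> (moves X)\<^sup>*"
proof -
  obtain vs A ws B where lm: "l = (vs, A)" "m = (ws, B)" by (meson surj_pair)
  have "(([] @ vs, A), ([] @ ws, A)) \<in> (moves X)\<^sup>*"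
    using assms lm by (intro perm_connected[OF X]) (auto simp: labellings_def)
  moreover have "((ws, A), (ws, B)) \<in> (moves X)\<^sup>*"
    using assms lm by (intro arrows_connected[OF X refl]) (auto simp: labellings_def)
  ultimately show ?thesis using lm by simp
qed

lemma same_orientation_iff:
  assumes X: "graph X"
  shows "(l, m) \<in> same_orientation X \<longleftrightarrow> l \<in> labellings X \<and> m \<in> labellings X \<and> par X l = par X m"
proof -
  have 1: "m \<in> labellings X \<and> par X l = par X m" if "(l, m) \<in> (moves X O moves X)\<^sup>*" "l \<in> labellings X"
    using that
  proof (induction rule: rtrancl_induct)
    case (step y z)
    then show ?case using moves_par[OF X] moves_labelling[OF X] by fastforce
  qed auto
  have 2: "(l, m) \<in> (moves X O moves X)\<^sup>* \<or> (l, m) \<in> (moves X O moves X)\<^sup>* O moves X"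
    if "(l, m) \<in> (moves X)\<^sup>*"
    using that
  proof (induction rule: rtrancl_induct)
    case (step y z)
    from step.IH show ?case
    proof
      assume "(l, y) \<in> (moves X O moves X)\<^sup>*"
      then show ?thesis using step.hyps(2) by blast
    next
      assume "(l, y) \<in> (moves X O moves X)\<^sup>* O moves X"
      then obtain k where k: "(l, k) \<in> (moves X O moves X)\<^sup>*" "(k, y) \<in> moves X" by blast
      then have "(k, z) \<in> moves X O moves X" using step.hyps(2) by blast
      with k(1) have "(l, z) \<in> (moves X O moves X)\<^sup>*" by (rule rtrancl_into_rtrancl)
      then show ?thesis ..
    qed
  qed auto
  have 3: "(l, m) \<in> (moves X O moves X)\<^sup>*" if l: "l \<in> labellings X" and m: "m \<in> labellings X" and p: "par X l = par X m"
  proof (rule ccontr)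
    assume "\<not> ?thesis"
    then obtain k where k: "(l, k) \<in> (moves X O moves X)\<^sup>*" "(k, m) \<in> moves X"
      using 2 moves_connected[OF X l m] by auto
    have "par X l = par X k"
      using k(1) l
    proof (induction rule: rtrancl_induct)
      case (step y z)
      then show ?case using moves_par[OF X] by fastforce
    qed auto
    then show False using moves_par[OF X k(2)] p par_pm[of X m] by auto
  qed
  show ?thesis using 1 3 by (auto simp: same_orientation_def)
qed

lemma orientations_iff:
  assumes X: "graph X"
  shows "\<omega> \<in> orientations X \<longleftrightarrow> (\<exists>l\<in>labellings X. \<omega> = {m \<in> labellings X. par X m = par X l})"
proof -
  have "same_orientation X `` {l} = {m \<in> labellings X. par X m = par X l}" if "l \<in> labellings X" for l
    using that by (auto simp: same_orientation_iff[OF X] simp del: par.simps)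
  then show ?thesis unfolding orientations_def quotient_def by auto
qed

abbreviation asign :: "pregraph \<Rightarrow> nat set \<Rightarrow> int" where
  "asign X A \<equiv> (\<Prod>h\<in>A. if bar X h < h then -1 else 1)"

abbreviation cls :: "pregraph \<Rightarrow> labelling \<Rightarrow> labelling set" where
  "cls X l \<equiv> {m \<in> labellings X. par X m = par X l}"

lemma cls_orientation: "graph X \<Longrightarrow> l \<in> labellings X \<Longrightarrow> cls X l \<in> orientations X"
  unfolding orientations_iff by blast

lemma orientation_cls: "graph X \<Longrightarrow> \<omega> \<in> orientations X \<Longrightarrow> l \<in> \<omega> \<Longrightarrow> l \<in> labellings X \<and> \<omega> = cls X l"
  unfolding orientations_iff by force

lemma orientation_nonempty: "graph X \<Longrightarrow> \<omega> \<in> orientations X \<Longrightarrow> \<exists>l. l \<in> \<omega>"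
  unfolding orientations_iff by blast

lemma opposite_move:
  assumes "graph X" "opposite X \<omega> \<omega>'" "l \<in> \<omega>" "(l, m) \<in> moves X"
  shows "m \<in> \<omega>'"
proof -
  obtain l' m' where *: "l' \<in> \<omega>" "m' \<in> \<omega>'" "(l', m') \<in> moves X" "\<omega> \<in> orientations X" "\<omega>' \<in> orientations X"
    using assms(2) by (auto simp: opposite_def)
  have "\<omega> = cls X l'" "\<omega>' = cls X m'" using orientation_cls[OF assms(1)] * by blast+
  moreover have "par X m' = - par X l'" "par X m = - par X l" using moves_par assms * by blast+
  ultimately show ?thesis using assms(3) moves_labelling[OF assms(1,4)] by auto
qed

lemma opposite_cls:
  assumes "graph X" "(l, m) \<in> moves X" shows "opposite X (cls X l) (cls X m)"
  using assms moves_labelling[OF assms] cls_orientation[OF assms(1)] unfolding opposite_def by blast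

subsection \<open>Isomorphisms\<close>

lemma graph_isoD:
  assumes "graph_iso X Y f g"
  shows "bij_betw f (verts X) (verts Y)" "bij_betw g (halves X) (halves Y)"
   "inj_on f (verts X)" "inj_on g (halves X)" "f ` verts X = verts Y" "g ` halves X = halves Y"
   "h \<in> halves X \<Longrightarrow> bar Y (g h) = g (bar X h)"
   "h \<in> halves X \<Longrightarrow> vert Y (g h) = f (vert X h)"
   "h \<in> halves X \<Longrightarrow> g h \<in> halves Y"
  using assms by (auto simp: graph_iso_def bij_betw_def)

lemma graph_iso_inv:
  assumes X: "graph X" and Y: "graph Y" and i: "graph_iso X Y f g"
  shows "graph_iso Y X (inv_into (verts X) f) (inv_into (halves X) g)"
  unfolding graph_iso_def
proof (intro conjI ballI)
  note I = graph_isoD[OF i]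
  show "bij_betw (inv_into (verts X) f) (verts Y) (verts X)" using I(1) bij_betw_inv_into by blast
  show "bij_betw (inv_into (halves X) g) (halves Y) (halves X)" using I(2) bij_betw_inv_into by blast
  fix h assume "h \<in> halves Y"
  then obtain k where k: "k \<in> halves X" "h = g k" using I(6) by blast
  show "bar X (inv_into (halves X) g h) = inv_into (halves X) g (bar Y h)"
    using k I graphD(4)[OF X k(1)] by simp
  show "vert X (inv_into (halves X) g h) = inv_into (verts X) f (vert Y h)"
    using k I graphD(3)[OF X k(1)] by simp
qed

lemma transport_labelling:
  assumes X: "graph X" and i: "graph_iso X Y f g" and l: "l \<in> labellings X"
  shows "transport f g l \<in> labellings Y"
proof -
  note I = graph_isoD[OF i]
  obtain vs A where lv: "l = (vs, A)" by fastforce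
  note L = labD[OF l[unfolded lv]]
  have "distinct (map f vs)" using L I(3) by (simp add: distinct_map)
  moreover have "set (map f vs) = verts Y" using L I(5) by auto
  moreover have "g ` A \<subseteq> halves Y" using L(3) I(6) by blast
  moreover have *: "g k \<in> g ` A \<longleftrightarrow> bar Y (g k) \<notin> g ` A" if k: "k \<in> halves X" for k
    using I(7)[OF k] inj_on_image_mem_iff[OF I(4) _ L(3)] k graphD(4)[OF X k] L(4)[OF k] by simp
  have "k \<in> g ` A \<longleftrightarrow> bar Y k \<notin> g ` A" if k: "k \<in> halves Y" for k
  proof -
    obtain j where j: "j \<in> halves X" "k = g j" using k I(6) by blast
    show ?thesis using *[OF j(1)] unfolding j(2) .
  qed
  ultimately show ?thesis unfolding lv transport_def labellings_def by simp
qed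

lemma transport_moves:
  assumes X: "graph X" and i: "graph_iso X Y f g" and lm: "(l, m) \<in> moves X"
  shows "(transport f g l, transport f g m) \<in> moves Y"
proof -
  note I = graph_isoD[OF i]
  obtain vs A ws B where lv: "l = (vs, A)" "m = (ws, B)" by (meson surj_pair)
  have l: "(vs, A) \<in> labellings X" using lm lv by (auto simp: moves_def)
  have t: "(map f vs, g ` A) \<in> labellings Y" using transport_labelling[OF X i l] by (simp add: transport_def)
  consider (s) i j where "i < j" "j < length vs" "ws = vs[i := vs ! j, j := vs ! i]" "B = A"
    | (f) h where "h \<in> A" "ws = vs" "B = insert (bar X h) (A - {h})"
    using lm lv by (auto simp: moves_def)
  then show ?thesis
  proof cases
    case s
    then show ?thesis using moves_swapI[OF t, of i j] lv by (simp add: transport_def map_update)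
  next
    case f
    have hH: "h \<in> halves X" using l f by (auto simp: labellings_def)
    have "g ` (A - {h}) = g ` A - {g h}"
      using inj_on_image_set_diff[OF I(4), of A "{h}"] labD(3)[OF l] hH by auto
    then show ?thesis using moves_flipI[OF t, of "g h"] f lv I(7)[OF hH] by (simp add: transport_def)
  qed
qed

lemma transport_same:
  assumes X: "graph X" and Y: "graph Y" and i: "graph_iso X Y f g" and lm: "(l, m) \<in> same_orientation X"
  shows "(transport f g l, transport f g m) \<in> same_orientation Y"
proof -
  have "(l, m) \<in> (moves X O moves X)\<^sup>*" "l \<in> labellings X" using lm by (auto simp: same_orientation_def)
  then have "(transport f g l, transport f g m) \<in> (moves Y O moves Y)\<^sup>*"
  proof (induction rule: rtrancl_induct)
    case (step y z)
    then have "(transport f g y, transport f g z) \<in> moves Y O moves Y"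
      using transport_moves[OF X i] by blast
    then show ?case using step by (meson rtrancl.rtrancl_into_rtrancl)
  qed auto
  then show ?thesis using transport_labelling[OF X i] \<open>l \<in> labellings X\<close> by (simp add: same_orientation_def)
qed

lemma transport_cls:
  assumes X: "graph X" and Y: "graph Y" and i: "graph_iso X Y f g" and l: "l \<in> labellings X"
  shows "transport f g ` cls X l = cls Y (transport f g l)"
proof -
  have cls: "cls Z k = {m. (k, m) \<in> same_orientation Z}" if "graph Z" "k \<in> labellings Z" for Z k
    using that by (auto simp: same_orientation_iff simp del: par.simps)
  let ?f = "inv_into (verts X) f" and ?g = "inv_into (halves X) g"
  have j: "graph_iso Y X ?f ?g" using graph_iso_inv[OF X Y i] .
  note I = graph_isoD[OF i]
  have inv1: "transport ?f ?g (transport f g m) = m" if "m \<in> labellings X" for m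
  proof -
    obtain vs A where m: "m = (vs, A)" by fastforce
    have "map (?f \<circ> f) vs = vs" using labD(2)[OF that[unfolded m]] I(3) by (intro map_idI) auto
    moreover have "?g ` g ` A = A" using labD(3)[OF that[unfolded m]] I(4)
      by (simp only: inv_into_image_cancel)
    ultimately show ?thesis by (simp add: m transport_def)
  qed
  have inv2: "transport f g (transport ?f ?g m) = m" if "m \<in> labellings Y" for m
  proof -
    obtain vs A where m: "m = (vs, A)" by fastforce
    have "map (f \<circ> ?f) vs = vs" using labD(2)[OF that[unfolded m]] I(5)
      by (intro map_idI) (auto simp: f_inv_into_f)
    moreover have "g ` ?g ` A = A" using labD(3)[OF that[unfolded m]] I(6)
      by (simp only: image_inv_into_cancel)
    ultimately show ?thesis by (simp add: m transport_def)
  qed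
  show ?thesis
  proof (intro equalityI subsetI)
    fix m assume "m \<in> transport f g ` cls X l"
    then obtain m' where "m = transport f g m'" "(l, m') \<in> same_orientation X" unfolding cls[OF X l] by blast
    then show "m \<in> cls Y (transport f g l)"
      unfolding cls[OF Y transport_labelling[OF X i l]] using transport_same[OF X Y i] by blast
  next
    fix m assume m: "m \<in> cls Y (transport f g l)"
    then have "(transport f g l, m) \<in> same_orientation Y" using cls[OF Y transport_labelling[OF X i l]] by auto
    from transport_same[OF Y X j this] have "transport ?f ?g m \<in> cls X l"
      using inv1[OF l] cls[OF X l] by simp
    moreover have "m = transport f g (transport ?f ?g m)" using m inv2 by simp
    ultimately show "m \<in> transport f g ` cls X l" by blast
  qed
qed

subsection \<open>Collapsing edges\<close>

lemma edgesE:
  assumes "graph X" "e \<in> edges X" "(vs, A) \<in> labellings X"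
  obtains h where "h \<in> A" "h \<in> halves X" "e = {h, bar X h}"
proof -
  obtain h where h: "h \<in> halves X" "e = {h, bar X h}" using assms by (auto simp: edges_def)
  show thesis
  proof (cases "h \<in> A")
    case False
    then have "bar X h \<in> A" using labD(4)[OF assms(3) h(1)] by simp
    then show ?thesis using that[of "bar X h"] h graphD[OF assms(1)] by auto
  qed (use h that in auto)
qed

lemma is_loop_iff: "is_loop X {h, k} \<longleftrightarrow> vert X h = vert X k"
  unfolding is_loop_def is_singleton_def by auto

lemma collapse_graph:
  assumes X: "graph X" and e: "e \<in> edges X" and nl: "\<not> is_loop X e"
  shows "graph (collapse X e)"
proof -
  note G = graphD[OF X]
  obtain h where h: "h \<in> halves X" "e = {h, bar X h}" using e by (auto simp: edges_def)
  let ?v = "vert X h" and ?w = "vert X (bar X h)"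
  let ?m = "Min (vert X ` e)"
  have vw: "?v \<noteq> ?w" using nl h is_loop_iff by metis
  have m: "?m = ?v \<or> ?m = ?w" using h by (simp add: min_def)
  have b: "bar X k \<notin> e" if "k \<in> halves X" "k \<notin> e" for k using that G(6) h by (metis insertE insertI1 insertI2 singletonD)
  have val: "3 \<le> card {k \<in> halves X - e. (if vert X k \<in> vert X ` e then ?m else vert X k) = u}"
    if u: "u \<in> verts X - vert X ` e \<union> {?m}" for u
  proof (cases "u = ?m")
    case False
    then have "{k \<in> halves X - e. (if vert X k \<in> vert X ` e then ?m else vert X k) = u} = {k \<in> halves X. vert X k = u}"
      using u by auto
    then show ?thesis using G(7)[of u] u False by simp
  next
    case True
    let ?V = "{k \<in> halves X. vert X k = ?v}" and ?W = "{k \<in> halves X. vert X k = ?w}"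
    have "{k \<in> halves X - e. (if vert X k \<in> vert X ` e then ?m else vert X k) = u} = (?V \<union> ?W) - e"
      using True h m by auto
    moreover have "card (?V \<union> ?W) = card ?V + card ?W"
      using G(2) vw by (intro card_Un_disjoint) auto
    moreover have "3 \<le> card ?V" "3 \<le> card ?W" using G(3,4,7) h(1) by auto
    moreover have "card e \<le> 2" using h(2) by (simp add: card_insert_if)
    moreover have "card (?V \<union> ?W) - card e \<le> card ((?V \<union> ?W) - e)"
      using h(2) by (intro diff_card_le_card_Diff) auto
    ultimately show ?thesis by simp
  qed
  show ?thesis unfolding graph_def collapse_def pregraph.simps
  proof (intro conjI ballI)
    show "finite (verts X - vert X ` e \<union> {?m})" "finite (halves X - e)" using G(1,2) by auto
    show "3 \<le> card {k \<in> halves X - e. (if vert X k \<in> vert X ` e then ?m else vert X k) = u}"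
      if "u \<in> verts X - vert X ` e \<union> {?m}" for u using val[OF that] .
  next
    fix k assume k: "k \<in> halves X - e"
    show "(if vert X k \<in> vert X ` e then ?m else vert X k) \<in> verts X - vert X ` e \<union> {?m}"
      using k G(3) by simp
    show "bar X k \<in> halves X - e" using k b G(4) by blast
    show "bar X k \<noteq> k" "bar X (bar X k) = k" using k G(5,6) by auto
  qed
qed

lemma collapse_lab:
  assumes X: "graph X" and l: "(vert X h # vert X (bar X h) # vs, A) \<in> labellings X"
    and h: "h \<in> A"
  shows "(Min (vert X ` {h, bar X h}) # vs, A - {h, bar X h}) \<in> labellings (collapse X {h, bar X h})"
proof -
  note L = labD[OF l]
  note G = graphD[OF X]
  have hH: "h \<in> halves X" using L h by auto
  have m: "Min (vert X ` {h, bar X h}) = vert X h \<or> Min (vert X ` {h, bar X h}) = vert X (bar X h)"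
    by (simp add: min_def)
  have "k \<in> A - {h, bar X h} \<longleftrightarrow> bar X k \<notin> A - {h, bar X h}" if k: "k \<in> halves X - {h, bar X h}" for k
  proof -
    have "bar X k \<noteq> h" "bar X k \<noteq> bar X h" using G(6)[of k] G(6)[OF hH] k by auto
    then show ?thesis using L(4) k by auto
  qed
  moreover have "set (Min (vert X ` {h, bar X h}) # vs) = verts X - vert X ` {h, bar X h} \<union> {Min (vert X ` {h, bar X h})}"
    using L(1,2) by auto
  moreover have "distinct (Min (vert X ` {h, bar X h}) # vs)" using L(1) m by auto
  moreover have "A - {h, bar X h} \<subseteq> halves X - {h, bar X h}" using L(3) by auto
  ultimately show ?thesis by (simp add: labellings_def collapse_def)
qed

lemma prod_list_perm:
  fixes f :: "nat \<Rightarrow> int"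
  assumes "distinct xs" "distinct ys" "set xs = set ys" shows "prod_list (map f xs) = prod_list (map f ys)"
  using assms by (metis prod.distinct_set_conv_list)

lemma par_collapse_aux:
  assumes X: "graph X"
    and l: "(vert X h # vert X (bar X h) # vs, A) \<in> labellings X" "h \<in> A"
    and l': "(vert X h # vert X (bar X h) # vs', A') \<in> labellings X" "h \<in> A'"
    and p: "par X (vert X h # vert X (bar X h) # vs, A) = par X (vert X h # vert X (bar X h) # vs', A')"
  shows "par (collapse X {h, bar X h}) (m # vs, A - {h, bar X h}) =
         par (collapse X {h, bar X h}) (m # vs', A' - {h, bar X h})"
proof -
  note L = labD[OF l(1)] and L' = labD[OF l'(1)]
  have hH: "h \<in> halves X" using L l by auto
  have b: "bar X h \<notin> A" "bar X h \<notin> A'" using L(4)[OF hH] L'(4)[OF hH] l l' by auto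
  have f: "finite A" "finite A'" using L(3) L'(3) graphD(2)[OF X] finite_subset by auto
  have "set vs = verts X - {vert X h, vert X (bar X h)}" using L(1,2) by auto
  moreover have "set vs' = verts X - {vert X h, vert X (bar X h)}" using L'(1,2) by auto
  ultimately have s: "set vs = set vs'" "distinct vs" "distinct vs'" using L(1) L'(1) by auto
  have pl: "prod_list (map f vs) = prod_list (map f vs')" for f :: "nat \<Rightarrow> int"
    using prod_list_perm s by blast
  have e: "A - {h, bar X h} = A - {h}" "A' - {h, bar X h} = A' - {h}" using b by auto
  have a: "asign X A = (if bar X h < h then -1 else 1) * asign X (A - {h, bar X h})"
    using f b l
    by (subst prod.remove[of A h]) (auto simp: e)
  have a': "asign X A' = (if bar X h < h then -1 else 1) * asign X (A' - {h, bar X h})"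
    using f b l' by (subst prod.remove[of A' h]) (auto simp: e)
  define q where "q = prod_list (map (\<lambda>y. if y < vert X h then -1 else (1::int)) (vert X (bar X h) # vs'))
     * prod_list (map (\<lambda>y. if y < vert X (bar X h) then -1 else (1::int)) vs')"
  define c :: int where "c = (if bar X h < h then -1 else 1)"
  have q0: "q \<noteq> 0" "c \<noteq> 0"
    unfolding q_def c_def by (auto simp: prod_list_zero_iff)
  have "par X (vert X h # vert X (bar X h) # vs, A) = (q * c) * (lsign vs * asign X (A - {h, bar X h}))"
    by (simp only: par.simps lsign.simps list.map prod_list.Cons pl a q_def c_def ac_simps)
  moreover have "par X (vert X h # vert X (bar X h) # vs', A') = (q * c) * (lsign vs' * asign X (A' - {h, bar X h}))"
    by (simp only: par.simps lsign.simps list.map prod_list.Cons a' q_def c_def ac_simps)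
  ultimately have "(q * c) * (lsign vs * asign X (A - {h, bar X h})) = (q * c) * (lsign vs' * asign X (A' - {h, bar X h}))"
    using p by presburger
  then have "lsign vs * asign X (A - {h, bar X h}) = lsign vs' * asign X (A' - {h, bar X h})"
    using q0 by (simp only: mult_cancel_left mult_eq_0_iff) blast
  then show ?thesis unfolding par.simps lsign.simps pl by (simp add: collapse_def mult.assoc)
qed

lemma par_collapse:
  assumes X: "graph X" and e: "e = {h, bar X h}" "e = {k, bar X k}"
    and l: "(vert X h # vert X (bar X h) # vs, A) \<in> labellings X" "h \<in> A"
    and l': "(vert X k # vert X (bar X k) # vs', A') \<in> labellings X" "k \<in> A'"
    and p: "par X (vert X h # vert X (bar X h) # vs, A) = par X (vert X k # vert X (bar X k) # vs', A')"
  shows "par (collapse X e) (m # vs, A - e) = par (collapse X e) (m # vs', A' - e)"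
proof (cases "h = k")
  case True
  then show ?thesis using par_collapse_aux[OF X l] l' p e by auto
next
  case False
  have hH: "h \<in> halves X" "k \<in> halves X" using l l' labD(3) by blast+
  have k: "k = bar X h" "bar X k = h" using False e graphD(6)[OF X hH(1)] by (auto simp: doubleton_eq_iff)
  let ?l = "(vert X k # vert X h # vs', A')"
  let ?l1 = "(vert X h # vert X k # vs', A')"
  let ?l2 = "(vert X h # vert X k # vs', insert h (A' - {k}))"
  have m1: "(?l, ?l1) \<in> moves X" using moves_swapI[OF l'(1), of 0 1] k by simp
  have m2: "(?l1, ?l2) \<in> moves X"
    using moves_flipI[OF _ l'(2), of "vert X h # vert X k # vs'" X] moves_labelling[OF X m1] k by simp
  have pp: "par X ?l2 = par X ?l" using moves_par[OF X m1] moves_par[OF X m2] by simp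
  have "par (collapse X {h, bar X h}) (m # vs, A - {h, bar X h}) =
        par (collapse X {h, bar X h}) (m # vs', insert h (A' - {k}) - {h, bar X h})"
    by (rule par_collapse_aux[OF X l]) (use moves_labelling[OF X m2] p pp k in \<open>simp_all del: par.simps\<close>)
  moreover have "insert h (A' - {k}) - {h, bar X h} = A' - e" using k e by auto
  ultimately show ?thesis using e(1) by simp
qed

lemma collapse_orientation_cls:
  assumes X: "graph X" and \<omega>: "\<omega> \<in> orientations X"
    and l: "(vert X h # vert X (bar X h) # vs, A) \<in> \<omega>" "h \<in> A" and e: "e = {h, bar X h}"
  shows "collapse_orientation X \<omega> e = cls (collapse X e) (Min (vert X ` e) # vs, A - e)"
    "(Min (vert X ` e) # vs, A - e) \<in> labellings (collapse X e)"
    "graph (collapse X e)"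
proof -
  have L: "(vert X h # vert X (bar X h) # vs, A) \<in> labellings X" using orientation_cls[OF X \<omega> l(1)] by blast
  have hH: "h \<in> halves X" using labD(3)[OF L] l by blast
  have "e \<in> edges X" using hH e by (auto simp: edges_def)
  moreover have "\<not> is_loop X e" unfolding e is_loop_iff using labD(1)[OF L] by auto
  ultimately show G: "graph (collapse X e)" using collapse_graph[OF X] by blast
  show lab: "(Min (vert X ` e) # vs, A - e) \<in> labellings (collapse X e)"
    unfolding e using collapse_lab[OF X L l(2)] .
  have "par (collapse X e) (Min (vert X ` e) # vs, A - e) = par (collapse X e) (Min (vert X ` e) # vs', A' - e)
    \<and> (Min (vert X ` e) # vs', A' - e) \<in> labellings (collapse X e)"
    if k: "k \<in> e" "k \<in> A'" "(vert X k # vert X (bar X k) # vs', A') \<in> \<omega>" for k vs' A'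
  proof -
    have L': "(vert X k # vert X (bar X k) # vs', A') \<in> labellings X" using orientation_cls[OF X \<omega> k(3)] by blast
    have ek: "e = {k, bar X k}" using k(1) e graphD(6)[OF X hH] by auto
    have "par X (vert X h # vert X (bar X h) # vs, A) = par X (vert X k # vert X (bar X k) # vs', A')"
      using orientation_cls[OF X \<omega> l(1)] k(3) by (auto simp del: par.simps)
    then show ?thesis using par_collapse[OF X e ek L l(2) L' k(2)] collapse_lab[OF X L' k(2)] ek by blast
  qed
  note * = this
  show "collapse_orientation X \<omega> e = cls (collapse X e) (Min (vert X ` e) # vs, A - e)"
  proof (intro equalityI subsetI)
    fix m assume "m \<in> collapse_orientation X \<omega> e"
    then obtain k vs' A' where k: "k \<in> e" "k \<in> A'" "(vert X k # vert X (bar X k) # vs', A') \<in> \<omega>"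
      "((Min (vert X ` e) # vs', A' - e), m) \<in> same_orientation (collapse X e)"
      unfolding collapse_orientation_def by blast
    then show "m \<in> cls (collapse X e) (Min (vert X ` e) # vs, A - e)"
      using *[OF k(1-3)] same_orientation_iff[OF G] by simp
  next
    fix m assume "m \<in> cls (collapse X e) (Min (vert X ` e) # vs, A - e)"
    then have "((Min (vert X ` e) # vs, A - e), m) \<in> same_orientation (collapse X e)"
      using same_orientation_iff[OF G] lab by (simp del: par.simps)
    then show "m \<in> collapse_orientation X \<omega> e" unfolding collapse_orientation_def using l e by blast
  qed
qed

lemma other_half:
  assumes X: "graph X" and l: "(vs, A) \<in> labellings X" and h: "h \<in> A"
  obtains k where "k \<in> A" "k \<noteq> h"
proof -
  have hH: "h \<in> halves X" using labD(3)[OF l] h by blast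
  have "\<not> {k \<in> halves X. vert X k = vert X h} \<subseteq> {h, bar X h}"
  proof
    assume "{k \<in> halves X. vert X k = vert X h} \<subseteq> {h, bar X h}"
    then have "card {k \<in> halves X. vert X k = vert X h} \<le> card {h, bar X h}" by (intro card_mono) auto
    then show False using graphD(7)[OF X graphD(3)[OF X hH]] by (simp add: card_insert_if split: if_splits)
  qed
  then obtain k where k: "k \<in> halves X" "k \<noteq> h" "k \<noteq> bar X h" by blast
  show thesis
  proof (cases "k \<in> A")
    case False
    then have "bar X k \<in> A" using labD(4)[OF l k(1)] by simp
    moreover have "bar X k \<noteq> h" using k graphD(6)[OF X k(1)] by auto
    ultimately show ?thesis using that by blast
  qed (use k that in auto)
qed

lemma good_labelling:
  assumes X: "graph X" and \<omega>: "\<omega> \<in> orientations X" and e: "e \<in> edges X" "\<not> is_loop X e"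
  obtains h vs A where "h \<in> A" "h \<in> halves X" "e = {h, bar X h}" "(vert X h # vert X (bar X h) # vs, A) \<in> \<omega>"
proof -
  obtain us A where u: "(us, A) \<in> \<omega>" using orientation_nonempty[OF X \<omega>] by auto
  have U: "(us, A) \<in> labellings X" "\<omega> = cls X (us, A)" using orientation_cls[OF X \<omega> u] by auto
  obtain h where h: "h \<in> A" "h \<in> halves X" "e = {h, bar X h}" using edgesE[OF X e(1) U(1)] .
  have vw: "vert X h \<noteq> vert X (bar X h)" using e h is_loop_iff by metis
  obtain vs where vs: "set vs = verts X - {vert X h, vert X (bar X h)}" "distinct vs"
    using graphD(1)[OF X] finite_distinct_list[of "verts X - {vert X h, vert X (bar X h)}"] by auto
  let ?vs = "vert X h # vert X (bar X h) # vs"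
  have L: "(?vs, A) \<in> labellings X"
    using U(1) vs vw graphD(3,4)[OF X] h(2) unfolding labellings_def by auto
  show thesis
  proof (cases "par X (?vs, A) = par X (us, A)")
    case True
    then have "(?vs, A) \<in> \<omega>" using L U(2) by blast
    then show thesis using that h by blast
  next
    case False
    obtain k where k: "k \<in> A" "k \<noteq> h" using other_half[OF X U(1) h(1)] .
    have m: "((?vs, A), (?vs, insert (bar X k) (A - {k}))) \<in> moves X" using moves_flipI[OF L k(1)] .
    have "par X (?vs, insert (bar X k) (A - {k})) = par X (us, A)"
      using moves_par[OF X m] False par_pm[of X "(?vs, A)"] par_pm[of X "(us, A)"] by (auto simp del: par.simps)
    then have "(?vs, insert (bar X k) (A - {k})) \<in> \<omega>" using moves_labelling[OF X m] U(2) by blast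
    moreover have "h \<in> insert (bar X k) (A - {k})" using h(1) k(2) by simp
    ultimately show thesis using that h(2,3) by metis
  qed
qed

lemma collapse_valid:
  assumes X: "graph X" and \<omega>: "\<omega> \<in> orientations X" and e: "e \<in> edges X" "\<not> is_loop X e"
  shows "graph (collapse X e)" "collapse_orientation X \<omega> e \<in> orientations (collapse X e)"
proof -
  obtain h vs A where h: "h \<in> A" "h \<in> halves X" "e = {h, bar X h}" "(vert X h # vert X (bar X h) # vs, A) \<in> \<omega>"
    using good_labelling[OF assms] .
  note C = collapse_orientation_cls[OF X \<omega> h(4,1,3)]
  show "graph (collapse X e)" by fact
  show "collapse_orientation X \<omega> e \<in> orientations (collapse X e)"
    unfolding C(1) using cls_orientation[OF C(3,2)] .
qed

lemma collapse_opposite: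
  assumes X: "graph X" and o: "opposite X \<omega> \<omega>'" and e: "e \<in> edges X" "\<not> is_loop X e"
  shows "opposite (collapse X e) (collapse_orientation X \<omega> e) (collapse_orientation X \<omega>' e)"
proof -
  have \<omega>: "\<omega> \<in> orientations X" "\<omega>' \<in> orientations X" using o by (auto simp: opposite_def)
  obtain h vs A where h: "h \<in> A" "h \<in> halves X" "e = {h, bar X h}" "(vert X h # vert X (bar X h) # vs, A) \<in> \<omega>"
    using good_labelling[OF X \<omega>(1) e] .
  have L: "(vert X h # vert X (bar X h) # vs, A) \<in> labellings X" using orientation_cls[OF X \<omega>(1) h(4)] by blast
  obtain k where k: "k \<in> A" "k \<noteq> h" using other_half[OF X L h(1)] .
  have kH: "k \<in> halves X" using k labD(3)[OF L] by blast
  have bA: "bar X h \<notin> A" using labD(4)[OF L h(2)] h(1) by blast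
  have bk: "bar X k \<noteq> h" "bar X k \<noteq> bar X h" "k \<noteq> bar X h"
    using bA k graphD(6)[OF X kH] graphD(6)[OF X h(2)] by auto
  let ?B = "insert (bar X k) (A - {k})"
  have "(vert X h # vert X (bar X h) # vs, ?B) \<in> \<omega>'"
    using opposite_move[OF X o h(4) moves_flipI[OF L k(1)]] .
  moreover have "h \<in> ?B" using h k by blast
  ultimately have C': "collapse_orientation X \<omega>' e = cls (collapse X e) (Min (vert X ` e) # vs, ?B - e)"
    using collapse_orientation_cls(1)[OF X \<omega>(2)] h(3) by blast
  note C = collapse_orientation_cls[OF X \<omega>(1) h(4,1,3)]
  have "?B - e = insert (bar (collapse X e) k) (A - e - {k})" using h(3) bk k by (auto simp: collapse_def)
  then have "((Min (vert X ` e) # vs, A - e), (Min (vert X ` e) # vs, ?B - e)) \<in> moves (collapse X e)"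
    using moves_flipI[OF C(2), of k] k bk h(3) by simp
  from opposite_cls[OF C(3) this] show ?thesis unfolding C(1) C' .
qed

lemma iso_edges:
  assumes X: "graph X" and i: "graph_iso X Y f g"
  shows "edges Y = (`) g ` edges X"
proof -
  note I = graph_isoD[OF i]
  have "edges Y = (\<lambda>h. {h, bar Y h}) ` halves Y" by (auto simp: edges_def)
  also have "\<dots> = (\<lambda>h. {g h, bar Y (g h)}) ` halves X" unfolding I(6)[symmetric] by (simp add: image_image)
  also have "\<dots> = (\<lambda>h. g ` {h, bar X h}) ` halves X" using I(7) by (intro image_cong) auto
  also have "\<dots> = (`) g ` (\<lambda>h. {h, bar X h}) ` halves X" by (simp only: image_image)
  also have "(\<lambda>h. {h, bar X h}) ` halves X = edges X" by (auto simp: edges_def)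
  finally show ?thesis .
qed

lemma edges_halves: "graph X \<Longrightarrow> e \<in> edges X \<Longrightarrow> e \<subseteq> halves X"
  using graphD(4) by (auto simp: edges_def)

lemma iso_vert_image:
  assumes i: "graph_iso X Y f g" and "S \<subseteq> halves X"
  shows "vert Y ` g ` S = f ` vert X ` S"
  using graph_isoD(8)[OF i] assms(2) by (auto simp: image_image intro!: image_cong)

lemma iso_loop:
  assumes X: "graph X" and i: "graph_iso X Y f g" and "e \<in> edges X"
  shows "is_loop Y (g ` e) \<longleftrightarrow> is_loop X e"
proof -
  obtain h where h: "h \<in> halves X" "e = {h, bar X h}" using assms by (auto simp: edges_def)
  have "is_loop Y (g ` e) \<longleftrightarrow> f (vert X h) = f (vert X (bar X h))"
    using h is_loop_iff graph_isoD(8)[OF i] graphD(4)[OF X] by simp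
  also have "\<dots> \<longleftrightarrow> vert X h = vert X (bar X h)"
    using graph_isoD(3)[OF i] graphD(3,4)[OF X] h(1) by (simp add: inj_on_eq_iff)
  finally show ?thesis using h is_loop_iff by simp
qed

lemma collapse_iso:
  assumes X: "graph X" and Y: "graph Y" and i: "graph_iso X Y f g" and \<omega>: "\<omega> \<in> orientations X"
    and e: "e \<in> edges X" "\<not> is_loop X e"
  shows "\<exists>f'. graph_iso (collapse X e) (collapse Y (g ` e)) f' g \<and>
     transport f' g ` collapse_orientation X \<omega> e = collapse_orientation Y (transport f g ` \<omega>) (g ` e)"
proof -
  note I = graph_isoD[OF i]
  obtain h vs A where h: "h \<in> A" "h \<in> halves X" "e = {h, bar X h}" "(vert X h # vert X (bar X h) # vs, A) \<in> \<omega>"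
    using good_labelling[OF X \<omega> e] .
  have L: "(vert X h # vert X (bar X h) # vs, A) \<in> labellings X" and \<omega>l: "\<omega> = cls X (vert X h # vert X (bar X h) # vs, A)"
    using orientation_cls[OF X \<omega> h(4)] by blast+
  note C = collapse_orientation_cls[OF X \<omega> h(4,1,3)]
  have bH: "bar X h \<in> halves X" using graphD(4)[OF X h(2)] .
  have \<omega>': "transport f g ` \<omega> \<in> orientations Y"
    unfolding \<omega>l transport_cls[OF X Y i L] using cls_orientation[OF Y transport_labelling[OF X i L]] .
  have "(vert Y (g h) # vert Y (bar Y (g h)) # map f vs, g ` A) = transport f g (vert X h # vert X (bar X h) # vs, A)"
    using I(7,8) h(2) bH by (simp add: transport_def)
  then have t: "(vert Y (g h) # vert Y (bar Y (g h)) # map f vs, g ` A) \<in> transport f g ` \<omega>" using h(4) by simp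
  have ge: "g ` e = {g h, bar Y (g h)}" using I(7) h by simp
  note C' = collapse_orientation_cls[OF Y \<omega>' t imageI[OF h(1)] ge]
  let ?m = "Min (vert X ` e)" and ?n = "Min (vert Y ` g ` e)"
  define f' where "f' = (\<lambda>u. if u = ?m then ?n else f u)"
  have ve: "vert X ` e \<subseteq> verts X" using h bH graphD(3)[OF X] by auto
  have eH: "e \<subseteq> halves X" using h bH by auto
  have vY: "vert Y ` g ` e = f ` vert X ` e" using iso_vert_image[OF i eH] .
  have mm: "?m \<in> vert X ` e" using h(3) by (intro Min_in) auto
  have nn: "?n \<in> f ` vert X ` e" unfolding vY[symmetric] using h(3) by (intro Min_in) auto
  have fm: "f u \<in> f ` vert X ` e \<longleftrightarrow> u \<in> vert X ` e" if "u \<in> verts X" for u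
    using inj_on_image_mem_iff[OF I(3) that ve] .
  have iso: "graph_iso (collapse X e) (collapse Y (g ` e)) f' g"
    unfolding graph_iso_def
  proof (intro conjI ballI)
    have "f' ` (verts X - vert X ` e) = f ` (verts X - vert X ` e)"
      using mm by (intro image_cong) (auto simp: f'_def)
    also have "\<dots> = verts Y - vert Y ` g ` e"
      unfolding vY I(5)[symmetric] using inj_on_image_set_diff[OF I(3)] ve by (simp add: image_set_diff)
    finally have im: "f' ` (verts X - vert X ` e) = verts Y - vert Y ` g ` e" .
    have "inj_on f' (verts X - vert X ` e)"
      using I(3) mm by (auto simp: f'_def inj_on_def)
    then have "bij_betw f' (verts X - vert X ` e) (verts Y - vert Y ` g ` e)" using im by (simp add: bij_betw_def)
    then show "bij_betw f' (verts (collapse X e)) (verts (collapse Y (g ` e)))"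
      unfolding collapse_def pregraph.simps
      using mm nn by (intro bij_betw_combine) (auto simp: f'_def vY bij_betw_def)
    show "bij_betw g (halves (collapse X e)) (halves (collapse Y (g ` e)))"
      using inj_on_image_set_diff[OF I(4), of "halves X" e] I(4,6) eH
      by (auto simp: collapse_def bij_betw_def inj_on_diff)
    fix k assume "k \<in> halves (collapse X e)"
    then have k: "k \<in> halves X" "k \<notin> e" by (auto simp: collapse_def)
    show "bar (collapse Y (g ` e)) (g k) = g (bar (collapse X e) k)" using I(7) k by (simp add: collapse_def)
    show "vert (collapse Y (g ` e)) (g k) = f' (vert (collapse X e) k)"
      using I(8)[OF k(1)] fm[OF graphD(3)[OF X k(1)]] mm by (auto simp: collapse_def vY f'_def)
  qed
  have vs: "?m \<notin> set vs" using labD(1)[OF L] mm h(3) by auto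
  have "transport f' g (?m # vs, A - e) = (?n # map f vs, g ` A - g ` e)"
    using vs inj_on_image_set_diff[OF I(4), of A e] labD(3)[OF L] eH by (auto simp: transport_def f'_def)
  then have "transport f' g ` collapse_orientation X \<omega> e = collapse_orientation Y (transport f g ` \<omega>) (g ` e)"
    unfolding C(1) C'(1) transport_cls[OF C(3) C'(3) iso C(2)] by simp
  then show ?thesis using iso by blast
qed

subsection \<open>Cutting and gluing\<close>

lemma half_edges_distinct:
  assumes X: "graph X" and hk: "h \<in> halves X" "k \<in> halves X" "h \<noteq> k" "k \<noteq> bar X h"
  shows "h \<noteq> bar X k" "bar X h \<noteq> bar X k" "h \<noteq> bar X h" "k \<noteq> bar X k" "bar X h \<noteq> h" "bar X k \<noteq> k" "bar X k \<noteq> h"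
    "bar X k \<noteq> bar X h" "bar X h \<noteq> k" "k \<noteq> h"
  using hk graphD(5,6)[OF X hk(1)] graphD(5,6)[OF X hk(2)] by auto

lemma cut_glue_simps [simp]:
  "verts (cut_glue X h k) = verts X" "halves (cut_glue X h k) = halves X" "vert (cut_glue X h k) = vert X"
  by (simp_all add: cut_glue_def)

lemma cut_glue_bar:
  assumes X: "graph X" and hk: "h \<in> halves X" "k \<in> halves X" "h \<noteq> k" "k \<noteq> bar X h"
  shows "bar (cut_glue X h k) h = k" "bar (cut_glue X h k) k = h"
    "bar (cut_glue X h k) (bar X h) = bar X k" "bar (cut_glue X h k) (bar X k) = bar X h"
    "x \<notin> {h, k, bar X h, bar X k} \<Longrightarrow> bar (cut_glue X h k) x = bar X x"
  by (simp_all add: cut_glue_def half_edges_distinct[OF assms] hk(3,4))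

lemma cut_glue_graph:
  assumes X: "graph X" and hk: "h \<in> halves X" "k \<in> halves X" "h \<noteq> k" "k \<noteq> bar X h"
  shows "graph (cut_glue X h k)"
proof -
  note D = half_edges_distinct[OF assms] and B = cut_glue_bar[OF assms]
  note G = graphD[OF X]
  have "bar (cut_glue X h k) x \<in> halves X \<and> bar (cut_glue X h k) x \<noteq> x \<and>
     bar (cut_glue X h k) (bar (cut_glue X h k) x) = x" if x: "x \<in> halves X" for x
  proof (cases "x \<in> {h, k, bar X h, bar X k}")
    case True
    then consider "x = h" | "x = k" | "x = bar X h" | "x = bar X k" by blast
    then show ?thesis by cases (simp_all add: B(1-4) D hk G(4)[OF hk(1)] G(4)[OF hk(2)])
  next
    case False
    then have "bar X x \<notin> {h, k, bar X h, bar X k}" using G(6)[OF x] G(6)[OF hk(1)] G(6)[OF hk(2)] by auto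
    then show ?thesis using B(5) False G(4-6)[OF x] by simp
  qed
  then show ?thesis unfolding graph_def using G(1-3,7) by simp
qed

lemma cut_glue_lab:
  assumes X: "graph X" and hk: "h \<in> halves X" "k \<in> halves X" "h \<noteq> k" "k \<noteq> bar X h"
    and l: "(vs, A) \<in> labellings X" "h \<in> A" "k \<notin> A"
  shows "(vs, A) \<in> labellings (cut_glue X h k)" "bar X h \<notin> A" "bar X k \<in> A"
proof -
  note D = half_edges_distinct[OF assms(1-5)] and B = cut_glue_bar[OF assms(1-5)]
  show b: "bar X h \<notin> A" "bar X k \<in> A" using labD(4)[OF l(1)] hk l by auto
  have "x \<in> A \<longleftrightarrow> bar (cut_glue X h k) x \<notin> A" if x: "x \<in> halves X" for x
  proof (cases "x \<in> {h, k, bar X h, bar X k}")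
    case True
    then show ?thesis using B(1-4) b l by auto
  next
    case False
    then show ?thesis using B(5) labD(4)[OF l(1) x] by simp
  qed
  then show "(vs, A) \<in> labellings (cut_glue X h k)" using l(1) by (simp add: labellings_def)
qed

lemma cut_glue_par:
  assumes X: "graph X" and hk: "h \<in> halves X" "k \<in> halves X" "h \<noteq> k" "k \<noteq> bar X h"
  shows "\<exists>c\<noteq>0. \<forall>vs A. (vs, A) \<in> labellings X \<longrightarrow> h \<in> A \<longrightarrow> k \<notin> A \<longrightarrow>
    par (cut_glue X h k) (vs, A) = c * par X (vs, A)"
proof -
  note D = half_edges_distinct[OF assms] and B = cut_glue_bar[OF assms]
  define s :: "pregraph \<Rightarrow> nat \<Rightarrow> int" where "s = (\<lambda>Y x. if bar Y x < x then -1 else 1)"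
  let ?Y = "cut_glue X h k"
  define c where "c = s ?Y h * s ?Y (bar X k) * s X h * s X (bar X k)"
  have ss: "s Y x * s Y x = 1" for Y x by (simp add: s_def)
  have "c \<noteq> 0" by (simp add: c_def s_def)
  moreover have "par ?Y (vs, A) = c * par X (vs, A)"
    if l: "(vs, A) \<in> labellings X" "h \<in> A" "k \<notin> A" for vs A
  proof -
    have b: "bar X h \<notin> A" "bar X k \<in> A" using labD(4)[OF l(1)] hk l by auto
    have f: "finite A" using labD(3)[OF l(1)] graphD(2)[OF X] finite_subset by auto
    have split: "prod (s Y) A = s Y h * (s Y (bar X k) * prod (s Y) (A - {h} - {bar X k}))" for Y
      using f l(2) b D by (simp add: prod.remove[of A h] prod.remove[of "A - {h}" "bar X k"])
    have "prod (s ?Y) (A - {h} - {bar X k}) = prod (s X) (A - {h} - {bar X k})"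
    proof (intro prod.cong refl)
      fix x assume "x \<in> A - {h} - {bar X k}"
      then have "x \<notin> {h, k, bar X h, bar X k}" using b l by auto
      then show "s ?Y x = s X x" using B(5) by (simp add: s_def)
    qed
    then have "prod (s ?Y) A = s ?Y h * (s ?Y (bar X k) * prod (s X) (A - {h} - {bar X k}))"
      unfolding split[of ?Y] by simp
    also have "\<dots> = (s X h * s X h) * (s X (bar X k) * s X (bar X k)) * \<dots>" unfolding ss by simp
    also have "\<dots> = c * prod (s X) A"
      unfolding split[of X] c_def by (simp only: ac_simps)
    finally show ?thesis by (simp add: s_def)
  qed
  ultimately show ?thesis by blast
qed

lemma cut_glue_orientation_cls:
  assumes X: "graph X" and hk: "h \<in> halves X" "k \<in> halves X" "h \<noteq> k" "k \<noteq> bar X h"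
    and \<omega>: "\<omega> \<in> orientations X" and l: "(vs, A) \<in> \<omega>" "h \<in> A" "k \<notin> A"
  shows "cut_glue_orientation X \<omega> h k = cls (cut_glue X h k) (vs, A)"
    "(vs, A) \<in> labellings (cut_glue X h k)"
proof -
  note G = cut_glue_graph[OF assms(1-5)]
  have L: "(vs, A) \<in> labellings X" "\<omega> = cls X (vs, A)" using orientation_cls[OF X \<omega> l(1)] by auto
  show lab: "(vs, A) \<in> labellings (cut_glue X h k)" using cut_glue_lab[OF assms(1-5) L(1) l(2,3)] by blast
  obtain c where c: "\<And>vs A. (vs, A) \<in> labellings X \<Longrightarrow> h \<in> A \<Longrightarrow> k \<notin> A \<Longrightarrow>
    par (cut_glue X h k) (vs, A) = c * par X (vs, A)" using cut_glue_par[OF assms(1-5)] by blast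
  show "cut_glue_orientation X \<omega> h k = cls (cut_glue X h k) (vs, A)"
  proof (intro equalityI subsetI)
    fix m assume "m \<in> cut_glue_orientation X \<omega> h k"
    then obtain ws B where *: "(ws, B) \<in> \<omega>" "h \<in> B" "k \<notin> B" "((ws, B), m) \<in> same_orientation (cut_glue X h k)"
      by (auto simp: cut_glue_orientation_def)
    have "(ws, B) \<in> labellings X" "par X (ws, B) = par X (vs, A)" using *(1) L(2) by blast+
    then have "par (cut_glue X h k) (ws, B) = par (cut_glue X h k) (vs, A)"
      using c[OF L(1) l(2,3)] c[of ws B] *(2,3) by presburger
    then show "m \<in> cls (cut_glue X h k) (vs, A)" using *(4) same_orientation_iff[OF G] by simp
  next
    fix m assume "m \<in> cls (cut_glue X h k) (vs, A)"
    then have "((vs, A), m) \<in> same_orientation (cut_glue X h k)"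
      using same_orientation_iff[OF G] lab by (simp del: par.simps)
    then show "m \<in> cut_glue_orientation X \<omega> h k" unfolding cut_glue_orientation_def using l by blast
  qed
qed

lemma two_verts:
  assumes "(vs, A) \<in> labellings X" "u \<in> verts X" "v \<in> verts X" "u \<noteq> v" shows "1 < length vs"
proof -
  have "{u, v} \<subseteq> set vs" using labD(2)[OF assms(1)] assms by auto
  then have "card {u, v} \<le> card (set vs)" by (intro card_mono) auto
  also have "\<dots> \<le> length vs" by (rule card_length)
  finally show ?thesis using assms by simp
qed

lemma cut_glue_good:
  assumes X: "graph X" and hk: "h \<in> halves X" "k \<in> halves X" "h \<noteq> k" "k \<noteq> bar X h"
    and \<omega>: "\<omega> \<in> orientations X" and vw: "vert X h \<noteq> vert X k"
  obtains vs A where "(vs, A) \<in> \<omega>" "h \<in> A" "k \<notin> A" "1 < length vs"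
proof -
  note D = half_edges_distinct[OF assms(1-5)]
  obtain us A where u: "(us, A) \<in> \<omega>" using orientation_nonempty[OF X \<omega>] by auto
  have U: "(us, A) \<in> labellings X" "\<omega> = cls X (us, A)" using orientation_cls[OF X \<omega> u] by auto
  define B where "B = (A - {bar X h, k}) \<union> {h, bar X k}"
  have mB: "h \<in> B" "bar X k \<in> B" "k \<notin> B" "bar X h \<notin> B" unfolding B_def by (auto simp: D)
  have "x \<in> B \<longleftrightarrow> bar X x \<notin> B" if x: "x \<in> halves X" for x
  proof (cases "x \<in> {h, k, bar X h, bar X k}")
    case True
    then consider "x = h" | "x = k" | "x = bar X h" | "x = bar X k" by blast
    then show ?thesis by cases (simp_all add: mB graphD(6)[OF X hk(1)] graphD(6)[OF X hk(2)])
  next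
    case False
    then have "bar X x \<notin> {h, k, bar X h, bar X k}"
      using graphD(6)[OF X x] graphD(6)[OF X hk(1)] graphD(6)[OF X hk(2)] by auto
    then show ?thesis unfolding B_def using False labD(4)[OF U(1) x] by auto
  qed
  moreover have "B \<subseteq> halves X"
    using labD(3)[OF U(1)] hk(1) graphD(4)[OF X hk(2)] unfolding B_def by blast
  ultimately have L: "(us, B) \<in> labellings X"
    using U(1) unfolding labellings_def by simp
  have len: "1 < length us" using two_verts[OF L _ _ vw] graphD(3)[OF X] hk by blast
  have B: "h \<in> B" "k \<notin> B" unfolding B_def by (auto simp: D)
  show thesis
  proof (cases "par X (us, B) = par X (us, A)")
    case True
    then have "(us, B) \<in> \<omega>" using L U(2) by blast
    then show thesis using that B len by blast
  next
    case False
    have m: "((us, B), (us[0 := us ! 1, 1 := us ! 0], B)) \<in> moves X" using moves_swapI[OF L _ len, of 0] by simp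
    have "par X (us[0 := us ! 1, 1 := us ! 0], B) = par X (us, A)"
      using moves_par[OF X m] False par_pm[of X "(us, B)"] par_pm[of X "(us, A)"] by (auto simp del: par.simps)
    then have "(us[0 := us ! 1, 1 := us ! 0], B) \<in> \<omega>" using moves_labelling[OF X m] U(2) by blast
    then show thesis using that B len by (metis length_list_update)
  qed
qed

lemma cut_glue_valid:
  assumes X: "graph X" and hk: "h \<in> halves X" "k \<in> halves X" "h \<noteq> k" "k \<noteq> bar X h"
    and \<omega>: "\<omega> \<in> orientations X" and vw: "vert X h \<noteq> vert X k"
  shows "cut_glue_orientation X \<omega> h k \<in> orientations (cut_glue X h k)"
    "{h, k} \<in> edges (cut_glue X h k)" "\<not> is_loop (cut_glue X h k) {h, k}"
proof -
  obtain vs A where l: "(vs, A) \<in> \<omega>" "h \<in> A" "k \<notin> A" using cut_glue_good[OF assms] .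
  show "cut_glue_orientation X \<omega> h k \<in> orientations (cut_glue X h k)"
    unfolding cut_glue_orientation_cls(1)[OF assms(1-6) l]
    using cls_orientation cut_glue_graph[OF assms(1-5)] cut_glue_orientation_cls(2)[OF assms(1-6) l] by blast
  show "{h, k} \<in> edges (cut_glue X h k)"
    unfolding edges_def using cut_glue_bar(1)[OF assms(1-5)] hk by force
  show "\<not> is_loop (cut_glue X h k) {h, k}" unfolding is_loop_iff using vw by simp
qed

lemma cut_glue_opposite:
  assumes X: "graph X" and hk: "h \<in> halves X" "k \<in> halves X" "h \<noteq> k" "k \<noteq> bar X h"
    and o: "opposite X \<omega> \<omega>'" and vw: "vert X h \<noteq> vert X k"
  shows "opposite (cut_glue X h k) (cut_glue_orientation X \<omega> h k) (cut_glue_orientation X \<omega>' h k)"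
proof -
  have \<omega>: "\<omega> \<in> orientations X" "\<omega>' \<in> orientations X" using o by (auto simp: opposite_def)
  obtain vs A where l: "(vs, A) \<in> \<omega>" "h \<in> A" "k \<notin> A" "1 < length vs"
    using cut_glue_good[OF assms(1-5) \<omega>(1) vw] .
  let ?ws = "vs[0 := vs ! 1, 1 := vs ! 0]"
  have L: "(vs, A) \<in> labellings X" using orientation_cls[OF X \<omega>(1) l(1)] by auto
  have "(?ws, A) \<in> \<omega>'" using opposite_move[OF X o l(1) moves_swapI[OF L _ l(4), of 0]] by simp
  note C' = cut_glue_orientation_cls(1)[OF assms(1-5) \<omega>(2) this l(2,3)]
  note C = cut_glue_orientation_cls[OF assms(1-5) \<omega>(1) l(1-3)]
  show ?thesis unfolding C(1) C'
    by (rule opposite_cls[OF cut_glue_graph[OF assms(1-5)]]) (use moves_swapI[OF C(2) _ l(4), of 0] in simp)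
qed

lemma cut_glue_iso:
  assumes X: "graph X" and Y: "graph Y" and i: "graph_iso X Y f g"
    and hk: "h \<in> halves X" "k \<in> halves X" "h \<noteq> k" "k \<noteq> bar X h"
    and \<omega>: "\<omega> \<in> orientations X" and vw: "vert X h \<noteq> vert X k"
  shows "graph_iso (cut_glue X h k) (cut_glue Y (g h) (g k)) f g"
    "transport f g ` cut_glue_orientation X \<omega> h k = cut_glue_orientation Y (transport f g ` \<omega>) (g h) (g k)"
    "g h \<in> halves Y" "g k \<in> halves Y" "g h \<noteq> g k" "g k \<noteq> bar Y (g h)" "vert Y (g h) \<noteq> vert Y (g k)"
proof -
  note I = graph_isoD[OF i]
  note G = graphD[OF X]
  show hk': "g h \<in> halves Y" "g k \<in> halves Y" "g h \<noteq> g k" "g k \<noteq> bar Y (g h)"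
    using I hk G(4)[OF hk(1)] by (auto simp: inj_on_eq_iff[OF I(4)])
  show "vert Y (g h) \<noteq> vert Y (g k)"
    using I(8) hk vw G(3) inj_on_eq_iff[OF I(3)] by simp
  note B = cut_glue_bar[OF X hk] and B' = cut_glue_bar[OF Y hk']
  show iso: "graph_iso (cut_glue X h k) (cut_glue Y (g h) (g k)) f g"
    unfolding graph_iso_def cut_glue_simps
  proof (intro conjI ballI I(1,2))
    fix x assume x: "x \<in> halves X"
    show "vert Y (g x) = f (vert X x)" using I(8)[OF x] .
    show "bar (cut_glue Y (g h) (g k)) (g x) = g (bar (cut_glue X h k) x)"
    proof (cases "x \<in> {h, k, bar X h, bar X k}")
      case True
      then show ?thesis using B(1-4) B'(1-4) I(7) hk by auto
    next
      case False
      then have "g x \<notin> {g h, g k, bar Y (g h), bar Y (g k)}"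
        using I(7) hk x G(4) by (auto simp: inj_on_eq_iff[OF I(4)])
      then show ?thesis using B(5) B'(5) False I(7)[OF x] by simp
    qed
  qed
  obtain vs A where l: "(vs, A) \<in> \<omega>" "h \<in> A" "k \<notin> A" using cut_glue_good[OF X hk \<omega> vw] .
  have L: "(vs, A) \<in> labellings X" and \<omega>l: "\<omega> = cls X (vs, A)" using orientation_cls[OF X \<omega> l(1)] by blast+
  have \<omega>': "transport f g ` \<omega> \<in> orientations Y"
    unfolding \<omega>l transport_cls[OF X Y i L] using cls_orientation[OF Y transport_labelling[OF X i L]] .
  have t: "(map f vs, g ` A) \<in> transport f g ` \<omega>"
    using l(1) by (auto simp: transport_def intro!: image_eqI[of _ _ "(vs, A)"])
  have gk: "g k \<notin> g ` A" using inj_on_image_mem_iff[OF I(4) hk(2) labD(3)[OF L]] l(3) by simp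
  note C = cut_glue_orientation_cls[OF X hk \<omega> l] 
  note C' = cut_glue_orientation_cls[OF Y hk' \<omega>' t imageI[OF l(2)] gk]
  show "transport f g ` cut_glue_orientation X \<omega> h k = cut_glue_orientation Y (transport f g ` \<omega>) (g h) (g k)"
    unfolding C(1) C'(1) transport_cls[OF cut_glue_graph[OF X hk] cut_glue_graph[OF Y hk'] iso C(2)]
    by (simp add: transport_def)
qed

lemma cut_glue_commute:
  assumes X: "graph X" and hk: "h \<in> halves X" "k \<in> halves X" "h \<noteq> k" "k \<noteq> bar X h"
    and \<omega>: "\<omega> \<in> orientations X" and vw: "vert X h \<noteq> vert X k"
  shows "cut_glue X k h = cut_glue X h k" "cut_glue_orientation X \<omega> k h = cut_glue_orientation X \<omega> h k"
proof -
  note D = half_edges_distinct[OF assms(1-5)] and B = cut_glue_bar[OF assms(1-5)]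
  have "(bar X)(k := h, h := k, bar X k := bar X h, bar X h := bar X k) =
     (bar X)(h := k, k := h, bar X h := bar X k, bar X k := bar X h)" by (rule ext) (simp add: D)
  then show e: "cut_glue X k h = cut_glue X h k" by (simp add: cut_glue_def)
  have kh: "k \<in> halves X" "h \<in> halves X" "k \<noteq> h" "h \<noteq> bar X k" using hk D(1) by simp_all
  obtain vs A where l: "(vs, A) \<in> \<omega>" "h \<in> A" "k \<notin> A" using cut_glue_good[OF assms] .
  have L: "(vs, A) \<in> labellings X" and \<omega>l: "\<omega> = cls X (vs, A)" using orientation_cls[OF X \<omega> l(1)] by blast+
  have b: "bar X h \<notin> A" "bar X k \<in> A" using cut_glue_lab[OF assms(1-5) L l(2,3)] by auto
  let ?Z = "cut_glue X h k"
  define A1 where "A1 = insert (bar X h) (A - {h})"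
  define A2 where "A2 = insert (bar X (bar X k)) (A1 - {bar X k})"
  have m1: "((vs, A), (vs, A1)) \<in> moves X" unfolding A1_def using moves_flipI[OF L l(2)] .
  have m2: "((vs, A1), (vs, A2)) \<in> moves X" unfolding A2_def
    by (rule moves_flipI) (use moves_labelling[OF X m1] b D(6,7) in \<open>simp_all add: A1_def\<close>)
  have "par X (vs, A2) = par X (vs, A)" using moves_par[OF X m1] moves_par[OF X m2] by simp
  then have l2: "(vs, A2) \<in> \<omega>" using moves_labelling[OF X m2] \<omega>l by blast
  have A2: "A2 = insert k (insert (bar X h) (A - {h} - {bar X k}))" unfolding A2_def A1_def
    by (auto simp: D graphD(6)[OF X hk(2)])
  have l2': "k \<in> A2" "h \<notin> A2" unfolding A2 by (auto simp: D hk(3))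
  note C = cut_glue_orientation_cls[OF assms(1-5) \<omega> l] 
  note C' = cut_glue_orientation_cls[OF X kh \<omega> l2 l2']
  note G = cut_glue_graph[OF assms(1-5)]
  define A3 where "A3 = insert (bar ?Z h) (A - {h})"
  have m3: "((vs, A), (vs, A3)) \<in> moves ?Z" unfolding A3_def using moves_flipI[OF C(2) l(2)] .
  have A4: "A2 = insert (bar ?Z (bar X k)) (A3 - {bar X k})" unfolding A2 A3_def B by (auto simp: D)
  have m4: "((vs, A3), (vs, A2)) \<in> moves ?Z" unfolding A4
    by (rule moves_flipI) (use moves_labelling[OF G m3] b D(7) in \<open>simp_all add: A3_def\<close>)
  have "par ?Z (vs, A2) = par ?Z (vs, A)" using moves_par[OF G m3] moves_par[OF G m4] by simp
  then show "cut_glue_orientation X \<omega> k h = cut_glue_orientation X \<omega> h k"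
    unfolding C(1) C'(1) e by (simp del: par.simps)
qed

subsection \<open>Operations on oriented graphs\<close>

lemma rep_valid: "graph (graph_of G)" "orientation_of G \<in> orientations (graph_of G)"
  using rep_oriented[of G] by (auto simp: case_prod_beta)

lemma collapse_edge_rep:
  assumes "e \<in> edges (graph_of G)" "\<not> is_loop (graph_of G) e"
  shows "graph_of (collapse_edge G e) = collapse (graph_of G) e"
    "orientation_of (collapse_edge G e) = collapse_orientation (graph_of G) (orientation_of G) e"
  using collapse_valid[OF rep_valid assms] by (auto simp: collapse_edge_def Oriented_inverse)

lemma cut_glue_rep:
  assumes "h \<in> halves (graph_of G)" "k \<in> halves (graph_of G)" "h \<noteq> k" "k \<noteq> bar (graph_of G) h"
    "vert (graph_of G) h \<noteq> vert (graph_of G) k"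
  shows "graph_of (cut_glue_oriented G h k) = cut_glue (graph_of G) h k"
    "orientation_of (cut_glue_oriented G h k) = cut_glue_orientation (graph_of G) (orientation_of G) h k"
  using cut_glue_graph[OF rep_valid(1) assms(1-4)] cut_glue_valid[OF rep_valid(1) assms(1-4) rep_valid(2) assms(5)]
  by (auto simp: cut_glue_oriented_def Oriented_inverse)

lemma collapse_edge_opp:
  assumes "opposite_oriented G G'" "e \<in> edges (graph_of G)" "\<not> is_loop (graph_of G) e"
  shows "opposite_oriented (collapse_edge G e) (collapse_edge G' e)"
proof -
  have o: "opposite (graph_of G) (orientation_of G) (orientation_of G')" and e: "graph_of G' = graph_of G"
    using assms(1) unfolding opposite_oriented_def by metis+
  note r = collapse_edge_rep[OF assms(2,3)] collapse_edge_rep[of e G', unfolded e, OF assms(2,3)]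
  show ?thesis unfolding opposite_oriented_def r
    using collapse_opposite[OF rep_valid(1) o assms(2,3)] by blast
qed

lemma collapse_edge_iso:
  assumes i: "graph_iso (graph_of G) (graph_of G') f g" "transport f g ` orientation_of G = orientation_of G'"
   and e: "e \<in> edges (graph_of G)" "\<not> is_loop (graph_of G) e"
  shows "isomorphic (collapse_edge G e) (collapse_edge G' (g ` e))"
proof -
  have e': "g ` e \<in> edges (graph_of G')" "\<not> is_loop (graph_of G') (g ` e)"
    using iso_edges[OF rep_valid(1) i(1)] iso_loop[OF rep_valid(1) i(1)] e by auto
  show ?thesis unfolding isomorphic_def collapse_edge_rep[OF e] collapse_edge_rep[OF e'] i(2)[symmetric]
    using collapse_iso[OF rep_valid(1) rep_valid(1) i(1) rep_valid(2) e] by blast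
qed

lemma cut_glue_oriented_opp:
  assumes "opposite_oriented G G'" and hk: "h \<in> halves (graph_of G)" "k \<in> halves (graph_of G)" "h \<noteq> k" "k \<noteq> bar (graph_of G) h"
    "vert (graph_of G) h \<noteq> vert (graph_of G) k"
  shows "opposite_oriented (cut_glue_oriented G h k) (cut_glue_oriented G' h k)"
proof -
  have o: "opposite (graph_of G) (orientation_of G) (orientation_of G')" and e: "graph_of G' = graph_of G"
    using assms(1) unfolding opposite_oriented_def by metis+
  note r = cut_glue_rep[OF hk] cut_glue_rep[of h G' k, unfolded e, OF hk]
  show ?thesis unfolding opposite_oriented_def r
    using cut_glue_opposite[OF rep_valid(1) hk(1-4) o hk(5)] by blast
qed

lemma pinch_opp:
  assumes "opposite_oriented G G'" and hk: "h \<in> halves (graph_of G)" "k \<in> halves (graph_of G)" "h \<noteq> k" "k \<noteq> bar (graph_of G) h"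
    "vert (graph_of G) h \<noteq> vert (graph_of G) k"
  shows "opposite_oriented (collapse_edge (cut_glue_oriented G h k) {h, k}) (collapse_edge (cut_glue_oriented G' h k) {h, k})"
  by (rule collapse_edge_opp[OF cut_glue_oriented_opp[OF assms]])
    (use cut_glue_valid(2,3)[OF rep_valid(1) hk(1-4) rep_valid(2) hk(5)] cut_glue_rep[OF hk] in auto)

lemma pinch_iso:
  assumes i: "graph_iso (graph_of G) (graph_of G') f g" "transport f g ` orientation_of G = orientation_of G'"
    and hk: "h \<in> halves (graph_of G)" "k \<in> halves (graph_of G)" "h \<noteq> k" "k \<noteq> bar (graph_of G) h"
    "vert (graph_of G) h \<noteq> vert (graph_of G) k"
  shows "isomorphic (collapse_edge (cut_glue_oriented G h k) {h, k})
     (collapse_edge (cut_glue_oriented G' (g h) (g k)) {g h, g k})"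
proof -
  note C = cut_glue_iso[OF rep_valid(1) rep_valid(1) i(1) hk(1-4) rep_valid(2) hk(5)]
  note V = cut_glue_valid(2,3)[OF rep_valid(1) hk(1-4) rep_valid(2) hk(5)]
  note r = cut_glue_rep[OF hk] cut_glue_rep[OF C(3-7)]
  have "isomorphic (collapse_edge (cut_glue_oriented G h k) {h, k})
     (collapse_edge (cut_glue_oriented G' (g h) (g k)) (g ` {h, k}))"
    by (rule collapse_edge_iso[of _ _ f]) (unfold r, use C(1,2) i(2) V in auto)
  then show ?thesis by simp
qed

lemma pinch_term_commute:
  assumes hk: "h \<in> halves (graph_of G)" "k \<in> halves (graph_of G)" "h \<noteq> k" "k \<noteq> bar (graph_of G) h"
  shows "pinch_term G k h = pinch_term G h k"
proof (cases "vert (graph_of G) h = vert (graph_of G) k")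
  case False
  then have "cut_glue_oriented G k h = cut_glue_oriented G h k"
    unfolding cut_glue_oriented_def using cut_glue_commute[OF rep_valid(1) hk rep_valid(2)] by simp
  then show ?thesis using False by (simp add: pinch_term_def insert_commute)
qed (simp add: pinch_term_def)

lemma pinch_term_pair:
  assumes hk: "h \<in> halves (graph_of G)" "k \<in> halves (graph_of G)" "h \<noteq> k" "k \<noteq> bar (graph_of G) h"
  shows "pinch_term G (Min {h, k}) (Max {h, k}) = pinch_term G h k"
  using pinch_term_commute[OF assms] by (cases "h \<le> k") (auto simp: min_def max_def)

subsection \<open>The generator formulas respect the relations\<close>

lemma linear_extension_superset:
  assumes "finite S" "Poly_Mapping.keys c \<subseteq> S"
  shows "linear_extension \<phi> c = (\<Sum>G\<in>S. chain_scale (Poly_Mapping.lookup c G) (\<phi> G))"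
  unfolding linear_extension_def using assms
  by (intro sum.mono_neutral_left) (auto simp: in_keys_iff chain.scale_zero_left)

lemma linear_extension_add: "linear_extension \<phi> (c + d) = linear_extension \<phi> c + linear_extension \<phi> d"
proof -
  let ?S = "Poly_Mapping.keys c \<union> Poly_Mapping.keys d"
  have s: "linear_extension \<phi> b = (\<Sum>G\<in>?S. chain_scale (Poly_Mapping.lookup b G) (\<phi> G))"
    if "Poly_Mapping.keys b \<subseteq> ?S" for b
    using that by (intro linear_extension_superset) auto
  show ?thesis using s[of c] s[of d] s[OF keys_add]
    by (simp add: lookup_add chain.scale_left_distrib sum.distrib)
qed

lemma linear_extension_scale: "linear_extension \<phi> (chain_scale a c) = chain_scale a (linear_extension \<phi> c)"
proof -
  have "Poly_Mapping.keys (chain_scale a c) \<subseteq> Poly_Mapping.keys c" by (auto simp: in_keys_iff)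
  then have "linear_extension \<phi> (chain_scale a c) =
     (\<Sum>G\<in>Poly_Mapping.keys c. chain_scale (Poly_Mapping.lookup (chain_scale a c) G) (\<phi> G))"
    by (intro linear_extension_superset) auto
  then show ?thesis by (simp add: linear_extension_def chain.scale_sum_right)
qed

lemma linear_extension_uminus: "linear_extension \<phi> (- c) = - linear_extension \<phi> c"
  using linear_extension_scale[of \<phi> "-1" c] by simp

lemma linear_extension_diff: "linear_extension \<phi> (c - d) = linear_extension \<phi> c - linear_extension \<phi> d"
  using linear_extension_add[of \<phi> c "- d"] linear_extension_uminus[of \<phi> d] by simp

lemma linear_extension_single: "linear_extension \<phi> (Poly_Mapping.single G 1) = \<phi> G"
  by (simp add: linear_extension_def)

lemma linear_extension_respects:
  fixes \<phi> :: "oriented_graph \<Rightarrow> (oriented_graph \<Rightarrow>\<^sub>0 'k::field_char_0)"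
  assumes iso: "\<And>G G'. isomorphic G G' \<Longrightarrow> \<phi> G - \<phi> G' \<in> chain.span relations"
    and opp: "\<And>G G'. opposite_oriented G G' \<Longrightarrow> \<phi> G + \<phi> G' \<in> chain.span relations"
    and "gc_equiv c d"
  shows "gc_equiv (linear_extension \<phi> c) (linear_extension \<phi> d)"
proof -
  have "linear_extension \<phi> b \<in> chain.span relations" if "b \<in> chain.span relations" for b
    using that
  proof (induction rule: chain.span_induct)
    case base
    show ?case
      by (rule chain.subspaceI)
        (auto simp: linear_extension_add linear_extension_scale linear_extension_def[of _ 0]
          intro: chain.span_zero chain.span_add chain.span_scale)
  next
    case (step x)
    then consider G G' where "x = Poly_Mapping.single G 1 - Poly_Mapping.single G' 1" "isomorphic G G'"
      | G G' where "x = Poly_Mapping.single G 1 + Poly_Mapping.single G' 1" "opposite_oriented G G'"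
      unfolding relations_def opposite_oriented_def by blast
    then show ?case
      by cases (auto simp: linear_extension_add linear_extension_diff linear_extension_single iso opp)
  qed
  then show ?thesis using assms(3) unfolding gc_equiv_def linear_extension_diff[symmetric] by blast
qed

lemma single_iso: "isomorphic G G' \<Longrightarrow> Poly_Mapping.single G 1 - Poly_Mapping.single G' 1 \<in> chain.span relations"
  by (rule chain.span_base) (auto simp: relations_def)

lemma single_opp: "opposite_oriented G G' \<Longrightarrow> Poly_Mapping.single G 1 + Poly_Mapping.single G' 1 \<in> chain.span relations"
  by (rule chain.span_base) (auto simp: relations_def opposite_oriented_def)

lemma edges_image_inj:
  assumes "graph_iso X Y f g" "graph X" shows "inj_on ((`) g) (Pow (halves X))"
  using graph_isoD(4)[OF assms(1)] by (rule inj_on_image_Pow)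

lemma boundary_E_gen_iso:
  assumes "isomorphic G G'"
  shows "boundary_E_gen G - boundary_E_gen G' \<in> chain.span relations"
proof -
  obtain f g where i: "graph_iso (graph_of G) (graph_of G') f g" "transport f g ` orientation_of G = orientation_of G'"
    using assms by (auto simp: isomorphic_def)
  have "inj_on ((`) g) (edges (graph_of G))"
    using edges_image_inj[OF i(1) rep_valid(1)] edges_halves[OF rep_valid(1)] by (meson Pow_iff inj_on_subset subsetI)
  then have "boundary_E_gen G' = (\<Sum>e\<in>edges (graph_of G). collapse_term G' (g ` e))"
    unfolding boundary_E_gen_def iso_edges[OF rep_valid(1) i(1)] by (simp add: sum.reindex)
  then have "boundary_E_gen G - boundary_E_gen G' = (\<Sum>e\<in>edges (graph_of G). collapse_term G e - collapse_term G' (g ` e))"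
    by (simp add: boundary_E_gen_def sum_subtractf)
  also have "\<dots> \<in> chain.span relations"
  proof (rule chain.span_sum)
    fix e assume e: "e \<in> edges (graph_of G)"
    show "collapse_term G e - collapse_term G' (g ` e) \<in> chain.span relations"
      using iso_loop[OF rep_valid(1) i(1) e] single_iso[OF collapse_edge_iso[OF i e]] chain.span_zero
      by (auto simp: collapse_term_def)
  qed
  finally show ?thesis .
qed

lemma boundary_E_gen_opp:
  assumes "opposite_oriented G G'"
  shows "boundary_E_gen G + boundary_E_gen G' \<in> chain.span relations"
proof -
  have e: "graph_of G' = graph_of G" using assms by (simp add: opposite_oriented_def)
  have "boundary_E_gen G + boundary_E_gen G' = (\<Sum>e\<in>edges (graph_of G). collapse_term G e + collapse_term G' e)"
    by (simp add: boundary_E_gen_def sum.distrib e)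
  also have "\<dots> \<in> chain.span relations"
    by (rule chain.span_sum)
      (use single_opp[OF collapse_edge_opp[OF assms]] chain.span_zero in \<open>auto simp: collapse_term_def e\<close>)
  finally show ?thesis .
qed

lemma half_edge_pairsE:
  assumes "p \<in> half_edge_pairs X"
  obtains h k where "p = {h, k}" "h \<in> halves X" "k \<in> halves X" "h \<noteq> k" "k \<noteq> bar X h"
  using assms by (auto simp: half_edge_pairs_def)

lemma iso_pairs:
  assumes X: "graph X" and i: "graph_iso X Y f g"
  shows "half_edge_pairs Y = (`) g ` half_edge_pairs X"
proof -
  note I = graph_isoD[OF i]
  have iff: "g h \<noteq> g k \<and> g k \<noteq> bar Y (g h) \<longleftrightarrow> h \<noteq> k \<and> k \<noteq> bar X h" if "h \<in> halves X" "k \<in> halves X" for h k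
    using that I(7) graphD(4)[OF X] by (auto simp: inj_on_eq_iff[OF I(4)])
  show ?thesis
  proof (intro equalityI subsetI)
    fix p assume "p \<in> half_edge_pairs Y"
    then obtain h' k' where p: "p = {h', k'}" "h' \<in> halves Y" "k' \<in> halves Y" "h' \<noteq> k'" "k' \<noteq> bar Y h'"
      by (rule half_edge_pairsE)
    obtain h where h: "h \<in> halves X" "h' = g h" using p(2) I(6) by blast
    obtain k where k: "k \<in> halves X" "k' = g k" using p(3) I(6) by blast
    have "{h, k} \<in> half_edge_pairs X" unfolding half_edge_pairs_def using iff[OF h(1) k(1)] p(4,5) h k by blast
    moreover have "p = g ` {h, k}" using p h k by simp
    ultimately show "p \<in> (`) g ` half_edge_pairs X" by blast
  next
    fix p assume "p \<in> (`) g ` half_edge_pairs X"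
    then obtain q where q: "q \<in> half_edge_pairs X" "p = g ` q" by blast
    obtain h k where hk: "q = {h, k}" "h \<in> halves X" "k \<in> halves X" "h \<noteq> k" "k \<noteq> bar X h"
      using q(1) by (rule half_edge_pairsE)
    have "p = {g h, g k}" using q hk by simp
    then show "p \<in> half_edge_pairs Y" unfolding half_edge_pairs_def using iff[OF hk(2,3)] hk I(9) by blast
  qed
qed

lemma boundary_H_gen_iso:
  assumes "isomorphic G G'"
  shows "boundary_H_gen G - boundary_H_gen G' \<in> chain.span relations"
proof -
  obtain f g where i: "graph_iso (graph_of G) (graph_of G') f g" "transport f g ` orientation_of G = orientation_of G'"
    using assms by (auto simp: isomorphic_def)
  note I = graph_isoD[OF i(1)]
  have "half_edge_pairs (graph_of G) \<subseteq> Pow (halves (graph_of G))" by (auto simp: half_edge_pairs_def)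
  then have "inj_on ((`) g) (half_edge_pairs (graph_of G))"
    using edges_image_inj[OF i(1) rep_valid(1)] inj_on_subset by blast
  then have "boundary_H_gen G' = (\<Sum>p\<in>half_edge_pairs (graph_of G). pinch_term G' (Min (g ` p)) (Max (g ` p)))"
    unfolding boundary_H_gen_def iso_pairs[OF rep_valid(1) i(1)] by (simp add: sum.reindex)
  then have "boundary_H_gen G - boundary_H_gen G' = (\<Sum>p\<in>half_edge_pairs (graph_of G).
      pinch_term G (Min p) (Max p) - pinch_term G' (Min (g ` p)) (Max (g ` p)))"
    by (simp add: boundary_H_gen_def sum_subtractf)
  also have "\<dots> \<in> chain.span relations"
  proof (rule chain.span_sum)
    fix p assume "p \<in> half_edge_pairs (graph_of G)"
    then obtain h k where p: "p = {h, k}" and hk: "h \<in> halves (graph_of G)" "k \<in> halves (graph_of G)" "h \<noteq> k" "k \<noteq> bar (graph_of G) h"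
      by (rule half_edge_pairsE)
    have hk': "g h \<in> halves (graph_of G')" "g k \<in> halves (graph_of G')" "g h \<noteq> g k" "g k \<noteq> bar (graph_of G') (g h)"
      using I(7,9) hk graphD(4)[OF rep_valid(1) hk(1)] by (auto simp: inj_on_eq_iff[OF I(4)])
    have v: "vert (graph_of G') (g h) = vert (graph_of G') (g k) \<longleftrightarrow> vert (graph_of G) h = vert (graph_of G) k"
      using I(8) hk graphD(3)[OF rep_valid(1)] by (simp add: inj_on_eq_iff[OF I(3)])
    have "pinch_term G h k - pinch_term G' (g h) (g k) \<in> chain.span relations"
      using single_iso[OF pinch_iso[OF i hk]] chain.span_zero v by (auto simp: pinch_term_def)
    then show "pinch_term G (Min p) (Max p) - pinch_term G' (Min (g ` p)) (Max (g ` p)) \<in> chain.span relations"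
      unfolding p image_insert image_empty pinch_term_pair[OF hk] pinch_term_pair[OF hk'] .
  qed
  finally show ?thesis .
qed

lemma boundary_H_gen_opp:
  assumes "opposite_oriented G G'"
  shows "boundary_H_gen G + boundary_H_gen G' \<in> chain.span relations"
proof -
  have e: "graph_of G' = graph_of G" using assms by (simp add: opposite_oriented_def)
  have "boundary_H_gen G + boundary_H_gen G' = (\<Sum>p\<in>half_edge_pairs (graph_of G).
      pinch_term G (Min p) (Max p) + pinch_term G' (Min p) (Max p))"
    by (simp add: boundary_H_gen_def sum.distrib e)
  also have "\<dots> \<in> chain.span relations"
  proof (rule chain.span_sum)
    fix p assume "p \<in> half_edge_pairs (graph_of G)"
    then obtain h k where p: "p = {h, k}" and hk: "h \<in> halves (graph_of G)" "k \<in> halves (graph_of G)" "h \<noteq> k" "k \<noteq> bar (graph_of G) h"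
      by (rule half_edge_pairsE)
    have "pinch_term G h k + pinch_term G' h k \<in> chain.span relations"
      using single_opp[OF pinch_opp[OF assms hk]] chain.span_zero by (auto simp: pinch_term_def e)
    then show "pinch_term G (Min p) (Max p) + pinch_term G' (Min p) (Max p) \<in> chain.span relations"
      unfolding p pinch_term_pair[OF hk] pinch_term_pair[of h G' k, unfolded e, OF hk] .
  qed
  finally show ?thesis .
qed

subsection \<open>The two operators on the graph complex\<close>

lift_definition boundary_E :: "'k::field_char_0 graph_complex \<Rightarrow> 'k graph_complex"
  is "linear_extension boundary_E_gen"
  by (rule linear_extension_respects[OF boundary_E_gen_iso boundary_E_gen_opp])

lift_definition boundary_H :: "'k::field_char_0 graph_complex \<Rightarrow> 'k graph_complex"
  is "linear_extension boundary_H_gen"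
  by (rule linear_extension_respects[OF boundary_H_gen_iso boundary_H_gen_opp])

lemma linear_boundary_E: "Vector_Spaces.linear gc_scale gc_scale boundary_E"
  by unfold_locales (transfer; simp add: linear_extension_add linear_extension_scale gc_equiv_def chain.span_zero)+

lemma linear_boundary_H: "Vector_Spaces.linear gc_scale gc_scale boundary_H"
  by unfold_locales (transfer; simp add: linear_extension_add linear_extension_scale gc_equiv_def chain.span_zero)+


lemma gc_class_isomorphic: "isomorphic G G' \<Longrightarrow> gc_class G = gc_class G'"
  by transfer (simp add: gc_equiv_def single_iso)

lemma gc_class_opp: "opposite_oriented G G' \<Longrightarrow> gc_class G = - gc_class G'"
  by transfer (simp add: gc_equiv_def single_opp)

lemma abs_gc_zero: "abs_graph_complex 0 = 0"
  by (simp add: zero_graph_complex.abs_eq)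

lemma abs_gc_sum: "abs_graph_complex (\<Sum>x\<in>S. \<phi> x) = (\<Sum>x\<in>S. abs_graph_complex (\<phi> x))"
  by (induction S rule: infinite_finite_induct)
    (simp_all add: zero_graph_complex.abs_eq plus_graph_complex.abs_eq[symmetric])

lemma boundary_E_class:
  "boundary_E (gc_class G) =
     (\<Sum>e\<in>edges (graph_of G). if is_loop (graph_of G) e then 0 else gc_class (collapse_edge G e))"
  unfolding gc_class.abs_eq boundary_E.abs_eq linear_extension_single boundary_E_gen_def abs_gc_sum
  by (intro sum.cong) (auto simp: collapse_term_def abs_gc_zero)


lemma gc_class_loop:
  assumes "e \<in> edges (graph_of G)" "is_loop (graph_of G) e"
  shows "(gc_class G :: 'k::field_char_0 graph_complex) = 0"
proof -
  let ?X = "graph_of G"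
  note X = rep_valid(1)[of G]
  obtain vs A where l: "(vs, A) \<in> orientation_of G" using orientation_nonempty[OF rep_valid(1,2)[of G]] by auto
  have L: "(vs, A) \<in> labellings ?X" and \<omega>: "orientation_of G = cls ?X (vs, A)"
    using orientation_cls[OF rep_valid l] by blast+
  obtain h where h: "h \<in> A" "h \<in> halves ?X" "e = {h, bar ?X h}" using edgesE[OF X assms(1) L] .
  have bh: "bar ?X h \<in> halves ?X" "bar ?X h \<noteq> h" "bar ?X (bar ?X h) = h" "bar ?X h \<notin> A"
    using graphD(4-6)[OF X h(2)] labD(4)[OF L h(2)] h(1) by auto
  have v: "vert ?X (bar ?X h) = vert ?X h" using assms(2) h(3) is_loop_iff by metis
  let ?B = "insert (bar ?X h) (A - {h})"
  define g where "g = id(h := bar ?X h, bar ?X h := h)"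
  have m: "((vs, A), (vs, ?B)) \<in> moves ?X" using moves_flipI[OF L h(1)] .
  have gg: "g (g x) = x" for x using bh by (simp add: g_def)
  have gH: "g x \<in> halves ?X" if "x \<in> halves ?X" for x using that bh h by (simp add: g_def)
  have "bij_betw g (halves ?X) (halves ?X)"
    by (rule bij_betw_byWitness[of _ g]) (use gg gH in auto)
  moreover have "bar ?X (g x) = g (bar ?X x)" if x: "x \<in> halves ?X" for x
  proof -
    consider "x = h" | "x = bar ?X h" | "x \<noteq> h" "x \<noteq> bar ?X h" by blast
    then show ?thesis
    proof cases
      case 3
      then have "bar ?X x \<noteq> h" "bar ?X x \<noteq> bar ?X h" using graphD(6)[OF X x] bh(3) by metis+
      then show ?thesis using 3 by (simp add: g_def)
    qed (use bh in \<open>simp_all add: g_def\<close>)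
  qed
  moreover have "vert ?X (g x) = vert ?X x" for x using v by (simp add: g_def)
  ultimately have iso: "graph_iso ?X ?X id g" unfolding graph_iso_def by simp
  define G' where "G' = Oriented (?X, cls ?X (vs, ?B))"
  have "cls ?X (vs, ?B) \<in> orientations ?X" using cls_orientation[OF X] moves_labelling[OF X m] by blast
  then have r: "rep_oriented G' = (?X, cls ?X (vs, ?B))" using X by (simp add: G'_def Oriented_inverse)
  have "g ` A = ?B" using bh h by (auto simp: g_def image_iff)
  then have "transport id g (vs, A) = (vs, ?B)" by (simp add: transport_def)
  then have "transport id g ` orientation_of G = orientation_of G'"
    unfolding \<omega> r snd_conv transport_cls[OF X X iso L] by simp
  then have "isomorphic G G'" unfolding isomorphic_def using iso r by auto
  moreover have "opposite_oriented G G'" unfolding opposite_oriented_def r \<omega> using opposite_cls[OF X m] by simp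
  ultimately have "(gc_class G :: 'k graph_complex) = - gc_class G"
    using gc_class_isomorphic gc_class_opp by metis
  then have "gc_scale (2 :: 'k) (gc_class G) = 0"
    by (metis gc.scale_left_distrib gc.scale_one one_add_one add.right_inverse)
  then show ?thesis by simp
qed

end

theory Submission
  imports Defs
begin

text \<open>
  Write \<open>p = {h, k}\<close> and expand \<open>boundary_E (boundary_H G)\<close>.  After pinching \<open>p\<close>, the remaining
  edges are the edges \<open>e\<close> of \<open>G\<close> that contain neither \<open>h\<close> nor \<open>k\<close>, and one new edge, which
  consists of the complementary half-edges \<open>bar h\<close> and \<open>bar k\<close>.

  Collapsing two edges in the two possible orders gives opposite orientations, and cutting and
  gluing commutes with the collapse of an edge disjoint from \<open>p\<close>; hence the terms of the first
  kind are the negatives of the terms of \<open>boundary_H (boundary_E G)\<close>.  The terms of the second kind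
  cancel in pairs: \<open>X<hk>\<close> and \<open>X<bar k, bar h>\<close> agree with their orientations, so the terms
  of \<open>{h, k}\<close> and \<open>{bar h, bar k}\<close> collapse the same two edges in opposite orders.
\<close>

subsection \<open>Iterated collapse of unoriented graphs\<close>

text \<open>The effect on vertices of collapsing an edge with end points \<open>p\<close> and
  \<open>q\<close>. As a map on all vertices it turns an iterated collapse into a composition of
  maps and its vertex set into an image.\<close>

definition merge :: "nat \<Rightarrow> nat \<Rightarrow> nat \<Rightarrow> nat" where
  "merge p q v = (if v \<in> {p, q} then min p q else v)"

text \<open>Two edges of a path \<open>p\<close>, \<open>q\<close>, \<open>s\<close> are collapsed,
  the one at \<open>p\<close> and \<open>q\<close> first. Since \<open>min\<close> is associative,
  the outcome is symmetric in the three vertices, so the two orders of collapse will give equal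
  graphs and not merely isomorphic ones.\<close>

lemma merge_shared:
  assumes "s \<notin> {p, q}"
  shows "merge (merge p q q) (merge p q s) (merge p q k) =
    (if k \<in> {p, q, s} then min p (min q s) else k)"
proof -
  define m where "m = min p q"
  have 1: "merge p q q = m" "merge p q s = s" using assms by (simp_all add: merge_def m_def)
  have m: "m \<in> {p, q}" by (simp add: min_def m_def)
  have 2: "min p (min q s) = min m s" unfolding m_def by (rule min.assoc[symmetric])
  have 3: "merge p q k = (if k \<in> {p, q} then m else k)" unfolding merge_def m_def ..
  show ?thesis unfolding 1 2 3 merge_def[of m s]
    using m by auto
qed

text \<open>The case of two edges without a common end point: the first merge fixes \<open>r\<close>
  and \<open>s\<close>, so the two merges act independently. When \<open>p\<close> and
  \<open>q\<close> are also distinct from \<open>r\<close> and \<open>s\<close>, the two pairs can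
  be exchanged in the result.\<close>

lemma merge_disjoint:
  assumes "r \<notin> {p, q}" "s \<notin> {p, q}"
  shows "merge (merge p q r) (merge p q s) (merge p q k) =
    (if k \<in> {p, q} then min p q else if k \<in> {r, s} then min r s else k)"
proof -
  define m where "m = min p q"
  have 1: "merge p q r = r" "merge p q s = s" using assms by (simp_all add: merge_def)
  have m: "m \<in> {p, q}" by (simp add: min_def m_def)
  have 3: "merge p q k = (if k \<in> {p, q} then m else k)" unfolding merge_def m_def ..
  show ?thesis unfolding 1 3 merge_def[of r s] m_def[symmetric] using m assms by auto
qed

lemma is_loop_collapse_iff:
  "is_loop (collapse X {a, b}) {c, d} \<longleftrightarrow>
     vert X c = vert X d \<or> {vert X c, vert X d} \<subseteq> {vert X a, vert X b}"
  unfolding is_loop_iff by (auto simp: collapse_def min_def)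

text \<open>Both sides say that one of the two pairs has equal end vertices or that the pairs are
  parallel. Hence the terms omitted because of loops are the same for both orders of
  collapse.\<close>

lemma is_loop_or_collapse:
  "is_loop X {a, b} \<or> is_loop (collapse X {a, b}) {c, d} \<longleftrightarrow>
     is_loop X {c, d} \<or> is_loop (collapse X {c, d}) {a, b}"
  unfolding is_loop_collapse_iff unfolding is_loop_iff by auto

lemma collapse_pair:
  assumes "graph X" "a \<in> halves X" "b \<in> halves X"
  shows "collapse X {a, b} = \<lparr>verts = merge (vert X a) (vert X b) ` verts X,
     halves = halves X - {a, b}, bar = bar X, vert = merge (vert X a) (vert X b) \<circ> vert X\<rparr>"
proof -
  have "vert X a \<in> verts X" "vert X b \<in> verts X" using assms graphD(3) by blast+
  then have "verts X - {vert X a, vert X b} \<union> {min (vert X a) (vert X b)} =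
      merge (vert X a) (vert X b) ` verts X"
    by (auto simp: merge_def)
  then show ?thesis by (auto simp: collapse_def merge_def fun_eq_iff)
qed

subsection \<open>Representing orientations by labellings\<close>

text \<open>The half-edges are partitioned by the vertex at which they begin, and every vertex has
  valence at least 3. The bound supplies the spare edge in
  \<open>extend_to_labelling\<close>.\<close>

lemma card_halves:
  assumes X: "graph X"
  shows "3 * card (verts X) \<le> card (halves X)"
proof -
  note G = graphD[OF X]
  have "3 * card (verts X) = (\<Sum>v\<in>verts X. 3)" by simp
  also have "\<dots> \<le> (\<Sum>v\<in>verts X. card {h \<in> halves X. vert X h = v})"
    using G(7) by (intro sum_mono)
  also have "\<dots> = card (\<Union>v\<in>verts X. {h \<in> halves X. vert X h = v})"
    using G(1,2) by (intro card_UN_disjoint[symmetric]) auto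
  also have "(\<Union>v\<in>verts X. {h \<in> halves X. vert X h = v}) = halves X" using G(3) by auto
  finally show ?thesis .
qed

text \<open>Every orientation has a representative with prescribed first vertices \<open>us\<close>
  and prescribed initial half-edges \<open>S\<close>. If the first attempt represents the opposite
  orientation, reversing the arrow on an edge that does not meet \<open>S\<close> corrects it; the
  cardinality bound guarantees such an edge.\<close>

lemma extend_to_labelling:
  assumes X: "graph X" and \<omega>: "\<omega> \<in> orientations X"
    and us: "distinct us" "set us \<subseteq> verts X"
    and S: "S \<subseteq> halves X" "\<And>s. s \<in> S \<Longrightarrow> bar X s \<notin> S" "2 * card S < 3 * card (verts X)"
  obtains vs A where "(us @ vs, A) \<in> \<omega>" "S \<subseteq> A"
proof -
  note G = graphD[OF X]
  obtain ws A0 where w: "(ws, A0) \<in> \<omega>" using orientation_nonempty[OF X \<omega>] by auto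
  have W: "(ws, A0) \<in> labellings X" "\<omega> = cls X (ws, A0)" using orientation_cls[OF X \<omega> w] by auto
  obtain vs where vs: "set vs = verts X - set us" "distinct vs"
    using G(1) finite_distinct_list[of "verts X - set us"] by auto
  \<comment> \<open>The arrows of \<open>A0\<close> are kept except on the edges meeting
    \<open>S\<close>, where they are made to start in \<open>S\<close>.\<close>
  define A where "A = (A0 - bar X ` S) \<union> S"
  have "x \<in> A \<longleftrightarrow> bar X x \<notin> A" if x: "x \<in> halves X" for x
  proof -
    have b: "y \<in> bar X ` S" if "bar X y \<in> S" "y \<in> halves X" for y
      using that by (intro rev_image_eqI[of "bar X y"]) (simp_all add: G(6))
    have b': "bar X y \<in> S" if "y \<in> bar X ` S" for y
      using that G(6) S(1) by auto
    have "x \<in> bar X ` S \<longleftrightarrow> bar X x \<in> S" "bar X x \<in> bar X ` S \<longleftrightarrow> x \<in> S"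
      using b[of x] b'[of x] b'[of "bar X x"] G(6)[OF x] x by auto
    then show ?thesis unfolding A_def using labD(4)[OF W(1) x] S(2) by blast
  qed
  then have L: "(us @ vs, A) \<in> labellings X"
    using labD(3)[OF W(1)] S(1) us vs unfolding labellings_def by (auto simp: A_def)
  have fS: "finite S" using S(1) G(2) finite_subset by blast
  \<comment> \<open>The edges meeting \<open>S\<close> have at most \<open>2 * card S\<close>
    half-edges, fewer than there are in \<open>X\<close>, so some half-edge \<open>x\<close> lies on
    none of them.\<close>
  have "card (S \<union> bar X ` S) \<le> card S + card (bar X ` S)" by (rule card_Un_le)
  also have "\<dots> \<le> 2 * card S" using card_image_le[OF fS, of "bar X"] by simp
  finally have "card (S \<union> bar X ` S) < card (halves X)" using S(3) card_halves[OF X] by linarith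
  then have "\<not> halves X \<subseteq> S \<union> bar X ` S"
    using fS by (meson card_mono finite_UnI finite_imageI linorder_not_le)
  then obtain x where x: "x \<in> halves X" "x \<notin> S" "x \<notin> bar X ` S" by blast
  have bx: "bar X x \<notin> S"
  proof
    assume "bar X x \<in> S"
    then have "bar X (bar X x) \<in> bar X ` S" by (rule imageI)
    then show False using x G(6)[OF x(1)] by simp
  qed
  \<comment> \<open>The initial half of the spare edge, whose arrow may be reversed without
    affecting \<open>S\<close>.\<close>
  obtain y where y: "y \<in> A" "y \<notin> S" "bar X y \<notin> S"
  proof (cases "x \<in> A")
    case True
    then show ?thesis using that x bx by blast
  next
    case False
    then show ?thesis using that[of "bar X x"] labD(4)[OF L x(1)] x bx G(6)[OF x(1)] by simp
  qed
  show thesis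
  proof (cases "par X (us @ vs, A) = par X (ws, A0)")
    case True
    then show thesis using that[of vs A] L W(2) by (simp add: A_def del: par.simps)
  next
    case False
    have m: "((us @ vs, A), (us @ vs, insert (bar X y) (A - {y}))) \<in> moves X"
      using moves_flipI[OF L y(1)] .
    have "par X (us @ vs, insert (bar X y) (A - {y})) = par X (ws, A0)"
      using moves_par[OF X m] False par_pm[of X "(us @ vs, A)"] par_pm[of X "(ws, A0)"]
      by (auto simp del: par.simps)
    then have "(us @ vs, insert (bar X y) (A - {y})) \<in> \<omega>"
      using moves_labelling[OF X m] W(2) by blast
    moreover have "S \<subseteq> insert (bar X y) (A - {y})" using y(2) by (auto simp: A_def)
    ultimately show thesis using that by blast
  qed
qed

text \<open>Working with a single representing labelling turns collapsing and gluing into operations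
  on lists and sets, and leaves the comparison of orientations to \<open>par\<close>.\<close>

definition oriented_by :: "pregraph \<Rightarrow> labelling \<Rightarrow> oriented_graph" where
  "oriented_by X l = Oriented (X, cls X l)"

lemma oriented_by_rep:
  assumes "graph X" "l \<in> labellings X"
  shows "graph_of (oriented_by X l) = X" "orientation_of (oriented_by X l) = cls X l"
  using cls_orientation[OF assms] assms(1)
  by (simp_all add: oriented_by_def Oriented_inverse del: par.simps)

lemma oriented_by_graph_of:
  assumes "l \<in> orientation_of G"
  shows "oriented_by (graph_of G) l = G"
proof -
  have "cls (graph_of G) l = orientation_of G" using orientation_cls[OF rep_valid assms] by simp
  then show ?thesis by (simp add: oriented_by_def rep_oriented_inverse del: par.simps)
qed

lemma oriented_by_cong: "par X l = par X m \<Longrightarrow> oriented_by X l = oriented_by X m"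
  by (simp add: oriented_by_def del: par.simps)

lemma oriented_by_opposite:
  assumes X: "graph X" and l: "(x # y # vs, A) \<in> labellings X"
  shows "opposite_oriented (oriented_by X (x # y # vs, A)) (oriented_by X (y # x # vs, A))"
proof -
  have m: "((x # y # vs, A), (y # x # vs, A)) \<in> moves X" using moves_swapI[OF l, of 0 1] by simp
  then show ?thesis
    unfolding opposite_oriented_def
    using oriented_by_rep[OF X] moves_labelling[OF X m] opposite_cls[OF X m] by simp
qed

lemma labellings_cong:
  "(vs, A) \<in> labellings X \<Longrightarrow> distinct ws \<Longrightarrow> set ws = set vs \<Longrightarrow> (ws, A) \<in> labellings X"
  by (simp add: labellings_def)

lemma par_swap_adjacent:
  "x \<noteq> y \<Longrightarrow> par X (as @ x # y # cs, A) = - par X (as @ y # x # cs, A)"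
  using lsign_swap_adjacent[of x y as cs] by simp

text \<open>A cyclic permutation of three entries is a product of two adjacent transpositions, hence
  even.\<close>

lemma par_rotate3:
  assumes "distinct [x, y, z]"
  shows "par X (y # z # x # cs, A) = par X (x # y # z # cs, A)"
proof -
  have "par X ([y] @ z # x # cs, A) = - par X ([y] @ x # z # cs, A)"
    by (rule par_swap_adjacent) (use assms in auto)
  moreover have "par X ([] @ y # x # z # cs, A) = - par X ([] @ x # y # z # cs, A)"
    by (rule par_swap_adjacent) (use assms in auto)
  ultimately show ?thesis unfolding append.simps by linarith
qed

text \<open>Exchanging two blocks of length two takes four adjacent transpositions, the first two of
  them grouped as a rotation.\<close>

lemma par_swap_blocks:
  assumes "distinct [x, y, z, w]"
  shows "par X (z # w # x # y # cs, A) = par X (x # y # z # w # cs, A)"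
proof -
  have "par X (z # w # x # y # cs, A) = par X (x # z # w # y # cs, A)"
    by (rule par_rotate3) (use assms in auto)
  moreover have "par X ([x, z] @ w # y # cs, A) = - par X ([x, z] @ y # w # cs, A)"
    by (rule par_swap_adjacent) (use assms in auto)
  moreover have "par X ([x] @ z # y # w # cs, A) = - par X ([x] @ y # z # w # cs, A)"
    by (rule par_swap_adjacent) (use assms in auto)
  ultimately show ?thesis unfolding append.simps by linarith
qed

text \<open>The end points enter as variables \<open>u\<close> and \<open>v\<close> with equations,
  so that the rule can be applied again to a collapsed graph, where an end point may have become a
  minimum.\<close>

lemma collapse_oriented_by:
  assumes X: "graph X" and l: "(u # v # vs, A) \<in> labellings X"
    and uv: "vert X h = u" "vert X k = v" and h: "h \<in> A" "bar X h = k"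
  shows "collapse_edge (oriented_by X (u # v # vs, A)) {h, k} =
      oriented_by (collapse X {h, k}) (min u v # vs, A - {h, k})"
    "graph (collapse X {h, k})" "(min u v # vs, A - {h, k}) \<in> labellings (collapse X {h, k})"
proof -
  let ?l = "(vert X h # vert X (bar X h) # vs, A)"
  have l': "?l \<in> labellings X" using l uv h by simp
  have "?l \<in> cls X ?l" using l' by blast
  note C = collapse_orientation_cls[OF X cls_orientation[OF X l'] this h(1) refl]
  have m: "Min (vert X ` {h, bar X h}) = min u v" using uv h by simp
  show "collapse_edge (oriented_by X (u # v # vs, A)) {h, k} =
      oriented_by (collapse X {h, k}) (min u v # vs, A - {h, k})"
    using C(1) oriented_by_rep[OF X l'] unfolding collapse_edge_def m
    by (simp add: oriented_by_def uv h del: par.simps)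
  show "graph (collapse X {h, k})" using C(3) h by simp
  show "(min u v # vs, A - {h, k}) \<in> labellings (collapse X {h, k})" using C(2) h uv by simp
qed

lemma cut_glue_oriented_by:
  assumes X: "graph X" and hk: "h \<in> halves X" "k \<in> halves X" "h \<noteq> k" "k \<noteq> bar X h"
    and l: "(vs, A) \<in> labellings X" "h \<in> A" "k \<notin> A"
  shows "cut_glue_oriented (oriented_by X (vs, A)) h k = oriented_by (cut_glue X h k) (vs, A)"
    "(vs, A) \<in> labellings (cut_glue X h k)"
proof -
  have "(vs, A) \<in> cls X (vs, A)" using l(1) by blast
  note C = cut_glue_orientation_cls[OF X hk cls_orientation[OF X l(1)] this l(2,3)]
  show "cut_glue_oriented (oriented_by X (vs, A)) h k = oriented_by (cut_glue X h k) (vs, A)"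
    using C(1) oriented_by_rep[OF X l(1)] by (simp add: cut_glue_oriented_def oriented_by_def del: par.simps)
  show "(vs, A) \<in> labellings (cut_glue X h k)" by (rule C(2))
qed

subsection \<open>Collapsing two edges\<close>

lemma collapse_vert_bar:
  "vert (collapse X {a, b}) k = merge (vert X a) (vert X b) (vert X k)" "bar (collapse X e) = bar X"
  by (simp_all add: collapse_def merge_def)

text \<open>A closed form for the composition of the two merges is left as the parameter
  \<open>\<phi>\<close>. Two orders of collapse that admit the same \<open>\<phi>\<close> then yield
  the same record.\<close>

lemma collapse_twice:
  assumes "graph X" "a \<in> halves X" "b \<in> halves X" "graph (collapse X {a, b})"
    and "c \<in> halves X" "d \<in> halves X" "{a, b} \<inter> {c, d} = {}"
    and \<phi>: "\<And>k. merge (merge (vert X a) (vert X b) (vert X c)) (merge (vert X a) (vert X b) (vert X d))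
      (merge (vert X a) (vert X b) k) = \<phi> k"
  shows "collapse (collapse X {a, b}) {c, d} = \<lparr>verts = \<phi> ` verts X,
     halves = halves X - {a, b, c, d}, bar = bar X, vert = \<phi> \<circ> vert X\<rparr>"
proof -
  have *: "c \<in> halves (collapse X {a, b})" "d \<in> halves (collapse X {a, b})"
    using assms by (auto simp: collapse_def)
  show ?thesis
    unfolding collapse_pair[OF assms(4) *] collapse_vert_bar
    unfolding collapse_pair[OF assms(1-3)]
    by (auto simp: image_image \<phi> fun_eq_iff)
qed

text \<open>The edges form a path from \<open>u\<close> over \<open>v\<close> to \<open>w\<close>,
  with initial halves \<open>a\<close> and \<open>c\<close>. With vertex order
  \<open>u, v, w\<close> both edges collapse in turn, \<open>{a, b}\<close> first, without
  renumbering. For the other order the numbering is rotated evenly to \<open>v, w, u\<close>; after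
  collapsing \<open>{c, d}\<close> the merged vertex stands before \<open>u\<close>, but
  \<open>{a, b}\<close> runs from \<open>u\<close> to it, and the transposition required gives the
  sign.\<close>

lemma collapse_twice_shared:
  assumes h: "a \<in> halves (graph_of G)" "c \<in> halves (graph_of G)"
    and bars: "bar (graph_of G) a = b" "bar (graph_of G) c = d"
    and v: "vert (graph_of G) b = vert (graph_of G) c"
      "distinct [vert (graph_of G) a, vert (graph_of G) c, vert (graph_of G) d]"
  shows "opposite_oriented (collapse_edge (collapse_edge G {c, d}) {a, b})
     (collapse_edge (collapse_edge G {a, b}) {c, d})"
proof -
  define X where "X = graph_of G"
  define u v w where uvw: "u = vert X a" "v = vert X c" "w = vert X d"
  note X = rep_valid(1)[of G, folded X_def]
  note G = graphD[OF X]
  note h = h[folded X_def] and bars = bars[folded X_def]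
  have bd: "b \<in> halves X" "d \<in> halves X" "bar X b = a" "bar X d = c" using h bars G(4,6) by auto
  have vert: "vert X a = u" "vert X b = v" "vert X c = v" "vert X d = w"
    using v(1) by (auto simp: uvw X_def)
  have uvw_dist: "distinct [u, v, w]" using v(2) unfolding uvw X_def .
  then have ne: "u \<noteq> v" "u \<noteq> w" "v \<noteq> w" by auto
  have ac: "a \<noteq> c" "a \<noteq> d" using vert(1,3,4) ne by blast+
  \<comment> \<open>Both \<open>b\<close> and \<open>c\<close> begin at \<open>v\<close>, so they
    are told apart through their complements \<open>a\<close> and \<open>d\<close>.\<close>
  then have "b \<noteq> c" "b \<noteq> d" using bd(3,4) bars(2) by blast+
  with ac have disj: "{a, b} \<inter> {c, d} = {}" by blast
  have vs: "set [u, v, w] \<subseteq> verts X" using G(3) h bd vert by auto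
  then have "card (set [u, v, w]) \<le> card (verts X)" using G(1) card_mono by blast
  then have "3 \<le> card (verts X)" using ne by simp
  moreover have "card {a, c} \<le> 2" by (simp add: card_insert_if)
  ultimately have card: "2 * card {a, c} < 3 * card (verts X)" by linarith
  have ends: "{a, c} \<subseteq> halves X" "\<And>s. s \<in> {a, c} \<Longrightarrow> bar X s \<notin> {a, c}"
    using h bars disj G(5) by auto
  obtain vs A where l: "([u, v, w] @ vs, A) \<in> orientation_of G" "{a, c} \<subseteq> A"
    using extend_to_labelling[OF X rep_valid(2)[of G, folded X_def] uvw_dist vs ends card] .
  have G1: "G = oriented_by X (u # v # w # vs, A)"
    using oriented_by_graph_of[OF l(1)] by (simp add: X_def)
  have L: "(u # v # w # vs, A) \<in> labellings X"
    using orientation_cls[OF rep_valid l(1)] by (simp add: X_def)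
  have G2: "G = oriented_by X (v # w # u # vs, A)"
    unfolding G1 by (rule oriented_by_cong[OF par_rotate3[OF uvw_dist], symmetric])
  have L2: "(v # w # u # vs, A) \<in> labellings X"
    using L by (rule labellings_cong) (use labD(1)[OF L] in auto)
  have A: "a \<in> A" "c \<in> A" using l(2) by auto
  note C = collapse_oriented_by[OF X L vert(1,2) A(1) bars(1)]
  have V1: "vert (collapse X {a, b}) c = min u v" "vert (collapse X {a, b}) d = w"
    using ne by (auto simp: collapse_vert_bar vert merge_def)
  note C' = collapse_oriented_by[OF C(2,3) V1, unfolded collapse_vert_bar, OF _ bars(2)]
  note D = collapse_oriented_by[OF X L2 vert(3,4) A(2) bars(2)]
  have V2: "vert (collapse X {c, d}) a = u" "vert (collapse X {c, d}) b = min v w"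
    using ne by (auto simp: collapse_vert_bar vert merge_def)
  have L3: "(u # min v w # vs, A - {c, d}) \<in> labellings (collapse X {c, d})"
    using D(3) by (rule labellings_cong) (use labD(1)[OF D(3)] in auto)
  note D' = collapse_oriented_by[OF D(2) L3 V2, unfolded collapse_vert_bar, OF _ bars(1)]
  \<comment> \<open>This exchange of the first two vertices is the only odd change in the
    comparison; every later step is an equality or preserves oppositeness.\<close>
  have "opposite_oriented (collapse_edge G {c, d}) (oriented_by (collapse X {c, d}) (u # min v w # vs, A - {c, d}))"
    unfolding G2 D(1) by (rule oriented_by_opposite[OF D(2,3)])
  moreover have "graph_of (collapse_edge G {c, d}) = collapse X {c, d}"
    unfolding G2 D(1) using oriented_by_rep[OF D(2,3)] by simp
  moreover have "{a, b} \<in> edges (collapse X {c, d})"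
    using disj h bars by (auto simp: edges_def collapse_def)
  moreover have "\<not> is_loop (collapse X {c, d}) {a, b}"
    unfolding is_loop_iff V2 using ne by linarith
  ultimately have "opposite_oriented (collapse_edge (collapse_edge G {c, d}) {a, b})
      (collapse_edge (oriented_by (collapse X {c, d}) (u # min v w # vs, A - {c, d})) {a, b})"
    using collapse_edge_opp by metis
  also have "collapse_edge (oriented_by (collapse X {c, d}) (u # min v w # vs, A - {c, d})) {a, b} =
      oriented_by (collapse (collapse X {c, d}) {a, b}) (min u (min v w) # vs, A - {c, d} - {a, b})"
    using D'(1) A disj by simp
  also have "collapse (collapse X {c, d}) {a, b} = collapse (collapse X {a, b}) {c, d}"
  proof -
    note 1 = collapse_twice[OF X h(1) bd(1) C(2) h(2) bd(2) disj, unfolded vert, OF merge_shared]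
    \<comment> \<open>The shared vertex \<open>v\<close> is now the first argument of the inner
      merge, so \<open>merge_shared\<close> is used with \<open>v\<close> and \<open>w\<close>
      exchanged, and the symmetry of \<open>merge\<close> and \<open>min\<close> does the
      rest.\<close>
    have m: "merge (merge v w u) (merge v w v) (merge v w k) = (if k \<in> {u, v, w} then min u (min v w) else k)" for k
      using merge_shared[of u w v k] ne
      by (auto simp: merge_def[of v w] merge_def[of w v] merge_def[of u] merge_def[of _ u] min.commute min.left_commute insert_commute)
    have "{c, d} \<inter> {a, b} = {}" using disj by blast
    note 2 = collapse_twice[OF X h(2) bd(2) D(2) h(1) bd(1) this, unfolded vert, OF m]
    show ?thesis using 1 2 ne by (simp add: insert_commute)
  qed
  also have "A - {c, d} - {a, b} = A - {a, b} - {c, d}" by blast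
  also have "min u (min v w) = min (min u v) w" by (simp add: min.assoc)
  also have "oriented_by (collapse (collapse X {a, b}) {c, d}) (min (min u v) w # vs, A - {a, b} - {c, d}) =
      collapse_edge (collapse_edge G {a, b}) {c, d}"
    unfolding G1 C(1) using C'(1) A disj by simp
  finally show ?thesis .
qed

text \<open>Moving the block \<open>x, y\<close> in front of \<open>u, v\<close>, or both in front
  of a merged vertex, is even. The two orders of collapse thus end with the two merged vertices in
  opposite order at the head of the list, which is one transposition.\<close>

lemma collapse_twice_disjoint:
  assumes h: "a \<in> halves (graph_of G)" "c \<in> halves (graph_of G)"
    and bars: "bar (graph_of G) a = b" "bar (graph_of G) c = d"
    and v: "distinct [vert (graph_of G) a, vert (graph_of G) b, vert (graph_of G) c, vert (graph_of G) d]"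
  shows "opposite_oriented (collapse_edge (collapse_edge G {c, d}) {a, b})
     (collapse_edge (collapse_edge G {a, b}) {c, d})"
proof -
  define X where "X = graph_of G"
  define u v x y where uv: "u = vert X a" "v = vert X b" "x = vert X c" "y = vert X d"
  note X = rep_valid(1)[of G, folded X_def]
  note G = graphD[OF X]
  note h = h[folded X_def] and bars = bars[folded X_def]
  have bd: "b \<in> halves X" "d \<in> halves X" "bar X b = a" "bar X d = c" using h bars G(4,6) by auto
  note vert = uv[symmetric]
  have dist: "distinct [u, v, x, y]" using v unfolding uv X_def .
  then have ne: "u \<noteq> v" "u \<noteq> x" "u \<noteq> y" "v \<noteq> x" "v \<noteq> y" "x \<noteq> y" by auto
  have ac: "a \<noteq> c" "a \<noteq> d" using vert(1,3,4) ne by blast+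
  then have "b \<noteq> c" "b \<noteq> d" using bd(3,4) bars(2) by blast+
  with ac have disj: "{a, b} \<inter> {c, d} = {}" by blast
  have vs: "set [u, v, x, y] \<subseteq> verts X" using G(3) h bd vert by auto
  then have "card (set [u, v, x, y]) \<le> card (verts X)" using G(1) card_mono by blast
  then have "4 \<le> card (verts X)" using ne by simp
  moreover have "card {a, c} \<le> 2" by (simp add: card_insert_if)
  ultimately have card: "2 * card {a, c} < 3 * card (verts X)" by linarith
  have ends: "{a, c} \<subseteq> halves X" "\<And>s. s \<in> {a, c} \<Longrightarrow> bar X s \<notin> {a, c}"
    using h bars disj G(5) by auto
  obtain vs A where l: "([u, v, x, y] @ vs, A) \<in> orientation_of G" "{a, c} \<subseteq> A"
    using extend_to_labelling[OF X rep_valid(2)[of G, folded X_def] dist vs ends card] .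
  have G1: "G = oriented_by X (u # v # x # y # vs, A)"
    using oriented_by_graph_of[OF l(1)] by (simp add: X_def)
  have L: "(u # v # x # y # vs, A) \<in> labellings X"
    using orientation_cls[OF rep_valid l(1)] by (simp add: X_def)
  have G2: "G = oriented_by X (x # y # u # v # vs, A)"
    unfolding G1 by (rule oriented_by_cong[OF par_swap_blocks[OF dist], symmetric])
  have L2: "(x # y # u # v # vs, A) \<in> labellings X"
    using L by (rule labellings_cong) (use labD(1)[OF L] in auto)
  have A: "a \<in> A" "c \<in> A" using l(2) by auto
  have mm: "min u v \<in> {u, v}" "min x y \<in> {x, y}" by (auto simp: min_def)
  note C = collapse_oriented_by[OF X L vert(1,2) A(1) bars(1)]
  have L3: "(x # y # min u v # vs, A - {a, b}) \<in> labellings (collapse X {a, b})"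
    using C(3) by (rule labellings_cong) (use labD(1)[OF C(3)] in auto)
  have P3: "oriented_by (collapse X {a, b}) (min u v # x # y # vs, A - {a, b}) =
      oriented_by (collapse X {a, b}) (x # y # min u v # vs, A - {a, b})"
    by (rule oriented_by_cong[OF par_rotate3, symmetric]) (use mm ne in auto)
  have V1: "vert (collapse X {a, b}) c = x" "vert (collapse X {a, b}) d = y"
    using ne by (auto simp: collapse_vert_bar vert merge_def)
  note C' = collapse_oriented_by[OF C(2) L3 V1, unfolded collapse_vert_bar, OF _ bars(2)]
  note D = collapse_oriented_by[OF X L2 vert(3,4) A(2) bars(2)]
  have L4: "(u # v # min x y # vs, A - {c, d}) \<in> labellings (collapse X {c, d})"
    using D(3) by (rule labellings_cong) (use labD(1)[OF D(3)] in auto)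
  have P4: "oriented_by (collapse X {c, d}) (min x y # u # v # vs, A - {c, d}) =
      oriented_by (collapse X {c, d}) (u # v # min x y # vs, A - {c, d})"
    by (rule oriented_by_cong[OF par_rotate3, symmetric]) (use mm ne in auto)
  have V2: "vert (collapse X {c, d}) a = u" "vert (collapse X {c, d}) b = v"
    using ne by (auto simp: collapse_vert_bar vert merge_def)
  note D' = collapse_oriented_by[OF D(2) L4 V2, unfolded collapse_vert_bar, OF _ bars(1)]
  have e: "collapse (collapse X {c, d}) {a, b} = collapse (collapse X {a, b}) {c, d}"
  proof -
    note 1 = collapse_twice[OF X h(1) bd(1) C(2) h(2) bd(2) disj, unfolded vert, OF merge_disjoint]
    have m: "merge (merge x y u) (merge x y v) (merge x y k) =
        (if k \<in> {u, v} then min u v else if k \<in> {x, y} then min x y else k)" for k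
      using merge_disjoint[of u x y v k] ne by auto
    have "{c, d} \<inter> {a, b} = {}" using disj by blast
    note 2 = collapse_twice[OF X h(2) bd(2) D(2) h(1) bd(1) this, unfolded vert, OF m]
    show ?thesis using 1 2 ne by (simp add: insert_commute)
  qed
  have s: "A - {c, d} - {a, b} = A - {a, b} - {c, d}" by blast
  have A': "a \<in> A - {c, d}" "c \<in> A - {a, b}" using A disj by auto
  have "collapse_edge (collapse_edge G {c, d}) {a, b} =
      oriented_by (collapse (collapse X {a, b}) {c, d}) (min u v # min x y # vs, A - {a, b} - {c, d})"
    unfolding G2 D(1) P4 D'(1)[OF A'(1)] e s ..
  moreover have "collapse_edge (collapse_edge G {a, b}) {c, d} =
      oriented_by (collapse (collapse X {a, b}) {c, d}) (min x y # min u v # vs, A - {a, b} - {c, d})"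
    unfolding G1 C(1) P3 C'(1)[OF A'(2)] ..
  moreover have "(min u v # min x y # vs, A - {a, b} - {c, d}) \<in> labellings (collapse (collapse X {a, b}) {c, d})"
    using D'(3)[OF A'(1)] unfolding e s .
  ultimately show ?thesis using oriented_by_opposite[OF C'(2)[OF A'(2)]] by simp
qed

text \<open>The hypotheses exclude loops and parallel edges, so \<open>e\<close> and
  \<open>f\<close> share exactly one end point or none. In the first case the halves are named so
  that the shared vertex belongs to the second half of \<open>e\<close> and the first half of
  \<open>f\<close>, which gives four cases.\<close>

lemma collapse_edge_commute:
  assumes e: "e \<in> edges (graph_of G)" "f \<in> edges (graph_of G)"
    and nl: "\<not> is_loop (graph_of G) e" "\<not> is_loop (collapse (graph_of G) e) f"
  shows "opposite_oriented (collapse_edge (collapse_edge G f) e) (collapse_edge (collapse_edge G e) f)"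
proof -
  define X where "X = graph_of G"
  note G = graphD[OF rep_valid(1)[of G, folded X_def]]
  obtain a where a: "e = {a, bar X a}" "a \<in> halves X" using e(1) by (auto simp: edges_def X_def)
  obtain c where c: "f = {c, bar X c}" "c \<in> halves X" using e(2) by (auto simp: edges_def X_def)
  define b d where bd: "b = bar X a" "d = bar X c"
  have ef: "e = {a, b}" "f = {c, d}" "e = {b, a}" "f = {d, c}" using a c bd by auto
  have H: "b \<in> halves X" "d \<in> halves X" "bar X b = a" "bar X d = c" "bar X a = b" "bar X c = d"
    using a(2) c(2) bd G(4,6) by simp_all
  note S = collapse_twice_shared[of _ G, folded X_def]
  have nl': "vert X a \<noteq> vert X b" "vert X c \<noteq> vert X d" "\<not> {vert X c, vert X d} \<subseteq> {vert X a, vert X b}"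
    using nl is_loop_collapse_iff[of X a b c d] is_loop_iff[of X a b]
    unfolding ef(1,2) X_def[symmetric] by blast+
  consider "vert X b = vert X c" | "vert X b = vert X d" | "vert X a = vert X c" | "vert X a = vert X d"
    | "vert X c \<notin> {vert X a, vert X b}" "vert X d \<notin> {vert X a, vert X b}"
    by (metis insertE singletonD)
  then show ?thesis
  proof cases
    case 1
    show ?thesis unfolding ef(1,2)
      by (rule S) (use 1 nl' a(2) c(2) H in auto)
  next
    case 2
    show ?thesis unfolding ef(1,4)
      by (rule S) (use 2 nl' a(2) c(2) H in auto)
  next
    case 3
    show ?thesis unfolding ef(2,3)
      by (rule S) (use 3 nl' a(2) c(2) H in auto)
  next
    case 4
    show ?thesis unfolding ef(3,4)
      by (rule S) (use 4 nl' a(2) c(2) H in auto)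
  next
    case 5
    show ?thesis unfolding ef(1,2)
      by (rule collapse_twice_disjoint) (use 5 nl' a(2) c(2) H in \<open>auto simp: X_def[symmetric]\<close>)
  qed
qed

subsection \<open>Pinching\<close>

text \<open>A collapse keeps \<open>bar\<close> and does not consult it, while cutting and gluing
  changes nothing but \<open>bar\<close>; the two therefore commute as operations on
  records.\<close>

lemma collapse_cut_glue: "collapse (cut_glue X h k) e = cut_glue (collapse X e) h k"
  unfolding collapse_def cut_glue_simps by (simp add: cut_glue_def)

text \<open>One labelling serves both operations: \<open>{a, b}\<close> runs from vertex 1 to vertex
  2, \<open>h\<close> is initial and \<open>k\<close> is terminal. Gluing keeps this labelling and
  the collapse changes it in the same way before and after gluing, so no sign appears.\<close>

lemma collapse_edge_cut_glue:
  assumes hk: "h \<in> halves (graph_of G)" "k \<in> halves (graph_of G)" "h \<noteq> k" "k \<noteq> bar (graph_of G) h"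
    and a: "a \<in> halves (graph_of G)" "bar (graph_of G) a = b" "{a, b} \<inter> {h, k} = {}"
    and nl: "\<not> is_loop (graph_of G) {a, b}" "\<not> is_loop (collapse (graph_of G) {a, b}) {h, k}"
  shows "collapse_edge (cut_glue_oriented G h k) {a, b} = cut_glue_oriented (collapse_edge G {a, b}) h k"
proof -
  define X where "X = graph_of G"
  note X = rep_valid(1)[of G, folded X_def]
  note G = graphD[OF X]
  note hk = hk[folded X_def] and a = a[folded X_def]
  note D = half_edges_distinct[OF X hk] and B = cut_glue_bar[OF X hk]
  have nl': "vert X a \<noteq> vert X b" "\<not> {vert X h, vert X k} \<subseteq> {vert X a, vert X b}"
    using nl is_loop_collapse_iff[of X a b h k] is_loop_iff[of X a b]
    unfolding X_def[symmetric] by blast+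
  have b: "b \<in> halves X" "bar X b = a" "a \<noteq> b" using a G(4,6) G(5)[OF a(1)] by auto
  have bk: "bar X k \<in> halves X" "bar X (bar X k) = k" "bar X h \<in> halves X" "bar X (bar X h) = h"
    using hk G(4,6) by auto
  have ab: "a \<notin> {h, k, bar X h, bar X k}" "b \<notin> {h, k, bar X h, bar X k}" using a b bk by auto
  \<comment> \<open>Since \<open>h\<close> and \<open>k\<close> do not both begin at ends of
    \<open>{a, b}\<close>, there is a third vertex. It is needed for the strict bound: three
    prescribed half-edges give 6, which two vertices would only match.\<close>
  obtain w where w: "w \<in> verts X" "w \<notin> {vert X a, vert X b}" using nl'(2) G(3) hk by blast
  have us: "distinct [vert X a, vert X b]" "set [vert X a, vert X b] \<subseteq> verts X"
    using nl' G(3) a(1) b(1) by auto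
  have "card {vert X a, vert X b, w} \<le> card (verts X)" using us w G(1) by (intro card_mono) auto
  moreover have "card {vert X a, vert X b, w} = 3" using w nl' by simp
  moreover have "card {a, h, bar X k} \<le> 3" by (simp add: card_insert_if)
  ultimately have card: "2 * card {a, h, bar X k} < 3 * card (verts X)" by linarith
  have ends: "{a, h, bar X k} \<subseteq> halves X" "\<And>s. s \<in> {a, h, bar X k} \<Longrightarrow> bar X s \<notin> {a, h, bar X k}"
    using a(1) hk bk ab b D a(2) by auto
  obtain vs A where l: "([vert X a, vert X b] @ vs, A) \<in> orientation_of G" "{a, h, bar X k} \<subseteq> A"
    using extend_to_labelling[OF X rep_valid(2)[of G, folded X_def] us ends card] .
  have G1: "G = oriented_by X (vert X a # vert X b # vs, A)"
    using oriented_by_graph_of[OF l(1)] by (simp add: X_def)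
  have L: "(vert X a # vert X b # vs, A) \<in> labellings X"
    using orientation_cls[OF rep_valid l(1)] by (simp add: X_def)
  have A: "a \<in> A" "h \<in> A" "k \<notin> A" using l(2) labD(4)[OF L hk(2)] by auto
  note C = collapse_oriented_by[OF X L refl refl A(1) a(2)]
  note U = cut_glue_oriented_by[OF X hk L A(2,3)]
  have "bar (cut_glue X h k) a = b" using B(5)[OF ab(1)] a(2) by simp
  note UC = collapse_oriented_by[OF cut_glue_graph[OF X hk] U(2) _ _ A(1) this, unfolded cut_glue_simps, OF refl refl]
  have "h \<in> halves (collapse X {a, b})" "k \<in> halves (collapse X {a, b})"
    using hk ab by (auto simp: collapse_def)
  moreover have "k \<noteq> bar (collapse X {a, b}) h" using hk(4) by (simp add: collapse_def)
  moreover have "h \<in> A - {a, b}" "k \<notin> A - {a, b}" using A ab by auto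
  ultimately have "cut_glue_oriented (collapse_edge G {a, b}) h k =
      oriented_by (cut_glue (collapse X {a, b}) h k) (min (vert X a) (vert X b) # vs, A - {a, b})"
    unfolding G1 C(1) by (intro cut_glue_oriented_by[OF C(2) _ _ hk(3) _ C(3)])
  then show ?thesis
    using UC(1) U(1) unfolding G1[symmetric] collapse_cut_glue by simp
qed

text \<open>The oriented graph in the nonzero case of \<open>pinch_term\<close>, indexed by the
  unordered pair.\<close>

definition pinch :: "oriented_graph \<Rightarrow> nat set \<Rightarrow> oriented_graph" where
  "pinch G p = collapse_edge (cut_glue_oriented G (Min p) (Max p)) p"

lemma half_edge_pairs_sortedE:
  assumes "graph X" "p \<in> half_edge_pairs X"
  obtains h k where "p = {h, k}" "Min p = h" "Max p = k"
    "h \<in> halves X" "k \<in> halves X" "h \<noteq> k" "k \<noteq> bar X h"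
proof -
  obtain h k where p: "p = {h, k}" "h \<in> halves X" "k \<in> halves X" "h \<noteq> k" "k \<noteq> bar X h"
    using assms(2) by (rule half_edge_pairsE)
  show thesis
  proof (cases "h \<le> k")
    case True
    then show ?thesis using that[of h k] p by simp
  next
    case False
    moreover have "h \<noteq> bar X k" using p(5) graphD(6)[OF assms(1) p(3)] by auto
    ultimately show ?thesis using that[of k h] p by (simp add: insert_commute)
  qed
qed

text \<open>Frees the pair from its numerical order, as \<open>bar\<close> need not preserve that
  order when passing to the complementary pair.\<close>

lemma pinch_pair:
  assumes hk: "h \<in> halves (graph_of G)" "k \<in> halves (graph_of G)" "h \<noteq> k" "k \<noteq> bar (graph_of G) h"
    and nl: "vert (graph_of G) h \<noteq> vert (graph_of G) k"
  shows "pinch G {h, k} = collapse_edge (cut_glue_oriented G h k) {h, k}"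
proof (cases "h \<le> k")
  case False
  have "cut_glue_oriented G k h = cut_glue_oriented G h k"
    unfolding cut_glue_oriented_def using cut_glue_commute[OF rep_valid(1) hk rep_valid(2) nl] by simp
  then show ?thesis using False by (simp add: pinch_def)
qed (simp add: pinch_def)

lemma pinch_rep:
  assumes p: "p \<in> half_edge_pairs (graph_of G)" "\<not> is_loop (graph_of G) p"
  shows "graph_of (pinch G p) = collapse (cut_glue (graph_of G) (Min p) (Max p)) p"
proof -
  let ?X = "graph_of G"
  obtain h k where hk: "p = {h, k}" "Min p = h" "Max p = k"
    "h \<in> halves ?X" "k \<in> halves ?X" "h \<noteq> k" "k \<noteq> bar ?X h"
    using half_edge_pairs_sortedE[OF rep_valid(1) p(1)] .
  have v: "vert ?X h \<noteq> vert ?X k" using p(2) hk(1) is_loop_iff by metis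
  note V = cut_glue_valid(2,3)[OF rep_valid(1) hk(4-7) rep_valid(2) v]
  note r = cut_glue_rep[OF hk(4-7) v]
  show ?thesis unfolding pinch_def hk(2,3)
    using collapse_edge_rep(1)[of p "cut_glue_oriented G h k"] V r hk(1) by simp
qed

section \<open>Edges, half-edge pairs and loops after collapsing and pinching\<close>

lemma edges_collapse:
  assumes X: "graph X" and e: "e \<in> edges X"
  shows "edges (collapse X e) = edges X - {e}"
proof -
  obtain a where a: "a \<in> halves X" "e = {a, bar X a}" using e by (auto simp: edges_def)
  have "{h, bar X h} = e \<longleftrightarrow> h \<in> e" if "h \<in> halves X" for h
    using a graphD(6)[OF X that] graphD(6)[OF X a(1)] by (auto simp: doubleton_eq_iff)
  then show ?thesis unfolding edges_def collapse_def by auto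
qed

lemma edges_cut_glue:
  assumes X: "graph X" and hk: "h \<in> halves X" "k \<in> halves X" "h \<noteq> k" "k \<noteq> bar X h"
  shows "edges (cut_glue X h k) = {e \<in> edges X. e \<inter> {h, k} = {}} \<union> {{h, k}, {bar X h, bar X k}}"
proof -
  note B = cut_glue_bar[OF assms] and G = graphD[OF X]
  let ?S = "{h, k, bar X h, bar X k}"
  have S: "?S \<subseteq> halves X" using hk G(4) by auto
  have "edges (cut_glue X h k) = (\<lambda>x. {x, bar (cut_glue X h k) x}) ` (halves X - ?S) \<union>
      (\<lambda>x. {x, bar (cut_glue X h k) x}) ` ?S"
    unfolding edges_def cut_glue_simps image_Un[symmetric] using S by (auto simp only: Un_Diff_cancel2 Un_absorb2 image_iff)
  also have "(\<lambda>x. {x, bar (cut_glue X h k) x}) ` ?S = {{h, k}, {bar X h, bar X k}}"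
    by (auto simp only: image_insert image_empty B(1-4) insert_commute)
  also have "(\<lambda>x. {x, bar (cut_glue X h k) x}) ` (halves X - ?S) = (\<lambda>x. {x, bar X x}) ` (halves X - ?S)"
    using B(5) by (intro image_cong) auto
  also have "\<dots> = {e \<in> edges X. e \<inter> {h, k} = {}}"
  proof -
    have "{x, bar X x} \<inter> {h, k} = {} \<longleftrightarrow> x \<notin> ?S" if "x \<in> halves X" for x
      using G(6)[OF that] G(6)[OF hk(1)] G(6)[OF hk(2)] by auto
    then show ?thesis by (auto simp: edges_def)
  qed
  finally show ?thesis .
qed

text \<open>The new edge joins the complements of \<open>h\<close> and \<open>k\<close>, which are
  not complementary in \<open>G\<close>, so it differs from every old edge. Its term can therefore
  be split off the sum over the edges of the pinched graph.\<close>

lemma pinch_edges: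
  assumes p: "p \<in> half_edge_pairs (graph_of G)" "\<not> is_loop (graph_of G) p"
  shows "edges (graph_of (pinch G p)) =
    insert (bar (graph_of G) ` p) {e \<in> edges (graph_of G). e \<inter> p = {}}"
    "bar (graph_of G) ` p \<notin> {e \<in> edges (graph_of G). e \<inter> p = {}}"
proof -
  let ?X = "graph_of G"
  note X = rep_valid(1)[of G]
  obtain h k where hk: "p = {h, k}" "Min p = h" "Max p = k"
    "h \<in> halves ?X" "k \<in> halves ?X" "h \<noteq> k" "k \<noteq> bar ?X h"
    using half_edge_pairs_sortedE[OF X p(1)] .
  note D = half_edges_distinct[OF X hk(4-7)] and G = graphD[OF X]
  have "vert ?X h \<noteq> vert ?X k" using p(2) hk(1) is_loop_iff by metis
  note V = cut_glue_valid(2)[OF X hk(4-7) rep_valid(2) this]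
  have E: "edges (graph_of (pinch G p)) = edges (cut_glue ?X h k) - {p}"
    unfolding pinch_rep[OF p] hk(2,3) using edges_collapse[OF cut_glue_graph[OF X hk(4-7)] V] hk(1) by simp
  have pb: "p \<noteq> bar ?X ` p" unfolding hk(1) using D by (auto simp: doubleton_eq_iff)
  have ne: "e \<noteq> p" if "e \<inter> p = {}" for e using that hk(1) by auto
  show "edges (graph_of (pinch G p)) = insert (bar ?X ` p) {e \<in> edges ?X. e \<inter> p = {}}"
    unfolding E edges_cut_glue[OF X hk(4-7)] using pb ne by (auto simp: hk(1))
  have "bar ?X ` p \<notin> edges ?X"
  proof
    assume "bar ?X ` p \<in> edges ?X"
    then obtain x where x: "x \<in> halves ?X" "{bar ?X h, bar ?X k} = {x, bar ?X x}"
      unfolding hk(1) by (auto simp: edges_def)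
    then have "bar ?X k = bar ?X (bar ?X h)" using G(6)[OF x(1)] by (auto simp: doubleton_eq_iff)
    then show False using D G(6)[OF hk(4)] by simp
  qed
  then show "bar ?X ` p \<notin> {e \<in> edges ?X. e \<inter> p = {}}" by blast
qed

text \<open>The condition \<open>e \<inter> p = {}\<close> is the one that singles out the old edges
  in \<open>pinch_edges\<close>, so both double sums run over the same pairs
  \<open>(e, p)\<close>.\<close>

lemma half_edge_pairs_collapse:
  assumes X: "graph X" and e: "e \<in> edges X"
  shows "half_edge_pairs (collapse X e) = {p \<in> half_edge_pairs X. e \<inter> p = {}}"
  unfolding half_edge_pairs_def by (auto simp: collapse_def)

lemma is_loop_cut_glue: "is_loop (cut_glue X h k) e \<longleftrightarrow> is_loop X e"
  by (simp add: is_loop_def)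

lemma is_loop_pinch:
  assumes "p \<in> half_edge_pairs (graph_of G)" "\<not> is_loop (graph_of G) p"
  shows "is_loop (graph_of (pinch G p)) e \<longleftrightarrow> is_loop (collapse (graph_of G) p) e"
  unfolding pinch_rep[OF assms] collapse_cut_glue is_loop_cut_glue ..

section \<open>Sign relations between single terms\<close>

definition collapse_class :: "oriented_graph \<Rightarrow> nat set \<Rightarrow> 'k::field_char_0 graph_complex" where
  "collapse_class G e = (if is_loop (graph_of G) e then 0 else gc_class (collapse_edge G e))"

text \<open>The pair \<open>p\<close> need not be an edge of the graph; \<open>is_loop\<close> then
  tests whether its two half-edges begin at the same vertex, the case in which the pinched graph is
  0.\<close>

definition pinch_class :: "oriented_graph \<Rightarrow> nat set \<Rightarrow> 'k::field_char_0 graph_complex" where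
  "pinch_class G p = (if is_loop (graph_of G) p then 0 else gc_class (pinch G p))"

text \<open>Pinching is a collapse in the glued graph, so both sides collapse \<open>p\<close> and
  \<open>e\<close> there, in opposite orders, once \<open>collapse_edge_cut_glue\<close> has moved
  the collapse of \<open>e\<close> past the gluing. The zero terms are included so that the identity
  can be summed.\<close>

lemma collapse_pinch_class:
  assumes p: "p \<in> half_edge_pairs (graph_of G)" and e: "e \<in> edges (graph_of G)" "e \<inter> p = {}"
  shows "(if is_loop (graph_of G) p then 0 else collapse_class (pinch G p) e) =
    - (if is_loop (graph_of G) e then 0 else
        (pinch_class (collapse_edge G e) p :: 'k::field_char_0 graph_complex))"
proof -
  let ?X = "graph_of G"
  note X = rep_valid(1)[of G]
  obtain h k where hk: "p = {h, k}" "Min p = h" "Max p = k"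
    "h \<in> halves ?X" "k \<in> halves ?X" "h \<noteq> k" "k \<noteq> bar ?X h"
    using half_edge_pairs_sortedE[OF X p] .
  obtain a b where a: "e = {a, b}" "a \<in> halves ?X" "bar ?X a = b" using e(1) by (auto simp: edges_def)
  \<comment> \<open>The disjunct \<open>is_loop ?X p\<close> is carried along because
    \<open>graph_of (pinch G p)\<close> is computed only for pairs with distinct end vertices; the
    next equivalence treats \<open>e\<close> likewise.\<close>
  have pl: "is_loop ?X p \<or> is_loop (graph_of (pinch G p)) e \<longleftrightarrow> is_loop ?X p \<or> is_loop (collapse ?X p) e"
    using is_loop_pinch[OF p] by blast
  have el: "is_loop ?X e \<or> is_loop (graph_of (collapse_edge G e)) p \<longleftrightarrow> is_loop ?X e \<or> is_loop (collapse ?X e) p"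
    using collapse_edge_rep(1)[OF e(1)] by metis
  have pe: "is_loop ?X p \<or> is_loop (collapse ?X p) e \<longleftrightarrow> is_loop ?X e \<or> is_loop (collapse ?X e) p"
    unfolding hk(1) a(1) by (rule is_loop_or_collapse)
  show ?thesis
  proof (cases "is_loop ?X p \<or> is_loop (graph_of (pinch G p)) e")
    case True
    then have "is_loop ?X e \<or> is_loop (graph_of (collapse_edge G e)) p" using pl el pe by blast
    with True show ?thesis unfolding collapse_class_def pinch_class_def by auto
  next
    case False
    then have nl: "\<not> is_loop ?X e" "\<not> is_loop (graph_of (collapse_edge G e)) p"
      "\<not> is_loop ?X p" "\<not> is_loop (collapse ?X e) p"
      using pl el pe by blast+
    have v: "vert ?X h \<noteq> vert ?X k" using nl(3) hk(1) is_loop_iff by metis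
    let ?G = "cut_glue_oriented G h k"
    note V = cut_glue_valid(2,3)[OF X hk(4-7) rep_valid(2) v]
    note r = cut_glue_rep(1)[OF hk(4-7) v]
    have "e \<in> edges (graph_of ?G)" unfolding r edges_cut_glue[OF X hk(4-7)] using e hk(1) by blast
    moreover have "p \<in> edges (graph_of ?G)" unfolding r using V hk(1) by simp
    moreover have "\<not> is_loop (graph_of ?G) e" unfolding r is_loop_cut_glue by (rule nl(1))
    moreover have "\<not> is_loop (collapse (graph_of ?G) e) p"
      unfolding r collapse_cut_glue is_loop_cut_glue by (rule nl(4))
    ultimately have "opposite_oriented (collapse_edge (collapse_edge ?G p) e) (collapse_edge (collapse_edge ?G e) p)"
      by (rule collapse_edge_commute)
    moreover have "collapse_edge ?G e = cut_glue_oriented (collapse_edge G e) h k"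
      unfolding a(1) by (rule collapse_edge_cut_glue) (use hk(4-7) a nl(1,4) e(2) hk(1) in auto)
    ultimately have "opposite_oriented (collapse_edge (pinch G p) e) (pinch (collapse_edge G e) p)"
      unfolding pinch_def hk(2,3) by simp
    from gc_class_opp[OF this] show ?thesis
      using False nl unfolding collapse_class_def pinch_class_def by simp
  qed
qed

lemma bar_image_pair:
  assumes X: "graph X" and p: "p \<in> half_edge_pairs X"
  shows "bar X ` p \<in> half_edge_pairs X" "bar X ` bar X ` p = p"
proof -
  obtain h k where hk: "p = {h, k}" "h \<in> halves X" "k \<in> halves X" "h \<noteq> k" "k \<noteq> bar X h"
    using p by (rule half_edge_pairsE)
  note D = half_edges_distinct[OF X hk(2-5)] and G = graphD[OF X]
  show "bar X ` bar X ` p = p" using hk G(6) by simp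
  have "bar X h \<in> halves X \<and> bar X k \<in> halves X \<and> bar X h \<noteq> bar X k \<and> bar X k \<noteq> bar X (bar X h)"
    using hk G(4,6) D by simp
  then show "bar X ` p \<in> half_edge_pairs X" unfolding hk(1) half_edge_pairs_def by auto
qed

text \<open>Both gluings join \<open>h\<close> to \<open>k\<close> and their complements to each
  other. Since \<open>h\<close> is initial exactly if \<open>bar X h\<close> is terminal, and
  likewise for \<open>k\<close>, listing the complements in reversed order admits the same
  labellings.\<close>

lemma cut_glue_bar_bar:
  assumes X: "graph X" and hk: "h \<in> halves X" "k \<in> halves X" "h \<noteq> k" "k \<noteq> bar X h"
    and \<omega>: "\<omega> \<in> orientations X"
  shows "cut_glue X (bar X k) (bar X h) = cut_glue X h k"
    "cut_glue_orientation X \<omega> (bar X k) (bar X h) = cut_glue_orientation X \<omega> h k"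
proof -
  note D = half_edges_distinct[OF X hk] and G = graphD[OF X]
  have b: "bar X (bar X h) = h" "bar X (bar X k) = k" using G(6) hk by auto
  have "(bar X)(bar X k := bar X h, bar X h := bar X k, k := h, h := k) =
      (bar X)(h := k, k := h, bar X h := bar X k, bar X k := bar X h)"
    by (rule ext) (simp add: D hk(3))
  then show e: "cut_glue X (bar X k) (bar X h) = cut_glue X h k"
    by (simp add: cut_glue_def b)
  have "(bar X k \<in> A \<and> bar X h \<notin> A) = (h \<in> A \<and> k \<notin> A)" if "(vs, A) \<in> \<omega>" for vs A
    using labD(4)[OF conjunct1[OF orientation_cls[OF X \<omega> that]]] hk by blast
  then show "cut_glue_orientation X \<omega> (bar X k) (bar X h) = cut_glue_orientation X \<omega> h k"
    unfolding cut_glue_orientation_def e by blast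
qed

text \<open>By \<open>cut_glue_bar_bar\<close> the pairs \<open>p\<close> and \<open>q\<close> lead
  to the same glued graph, in which they are the two new edges. The two terms collapse these edges
  in opposite orders.\<close>

lemma collapse_bar_pinch_class:
  assumes p: "p \<in> half_edge_pairs (graph_of G)"
  defines "q \<equiv> bar (graph_of G) ` p"
  shows "(if is_loop (graph_of G) q then 0 else collapse_class (pinch G q) p) =
    - (if is_loop (graph_of G) p then 0 else
        (collapse_class (pinch G p) q :: 'k::field_char_0 graph_complex))"
proof -
  let ?X = "graph_of G"
  note X = rep_valid(1)[of G]
  have q: "q \<in> half_edge_pairs ?X" unfolding q_def using bar_image_pair(1)[OF X p] .
  obtain h k where hk: "p = {h, k}" "h \<in> halves ?X" "k \<in> halves ?X" "h \<noteq> k" "k \<noteq> bar ?X h"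
    using p by (rule half_edge_pairsE)
  note D = half_edges_distinct[OF X hk(2-5)] and G = graphD[OF X]
  have qk: "q = {bar ?X k, bar ?X h}" unfolding q_def hk(1) by auto
  have pl: "is_loop ?X p \<or> is_loop (graph_of (pinch G p)) q \<longleftrightarrow> is_loop ?X p \<or> is_loop (collapse ?X p) q"
    using is_loop_pinch[OF p] by blast
  have ql: "is_loop ?X q \<or> is_loop (graph_of (pinch G q)) p \<longleftrightarrow> is_loop ?X q \<or> is_loop (collapse ?X q) p"
    using is_loop_pinch[OF q] by blast
  have pq: "is_loop ?X p \<or> is_loop (collapse ?X p) q \<longleftrightarrow> is_loop ?X q \<or> is_loop (collapse ?X q) p"
    unfolding hk(1) qk by (rule is_loop_or_collapse)
  show ?thesis
  proof (cases "is_loop ?X p \<or> is_loop (graph_of (pinch G p)) q")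
    case True
    then have "is_loop ?X q \<or> is_loop (graph_of (pinch G q)) p" using pl ql pq by blast
    with True show ?thesis unfolding collapse_class_def by auto
  next
    case False
    then have nl: "\<not> is_loop ?X q" "\<not> is_loop (graph_of (pinch G q)) p"
      "\<not> is_loop ?X p" "\<not> is_loop (collapse ?X q) p"
      using pl ql pq by blast+
    have v: "vert ?X h \<noteq> vert ?X k" "vert ?X (bar ?X k) \<noteq> vert ?X (bar ?X h)"
      using nl(1,3) hk(1) qk is_loop_iff by metis+
    let ?G = "cut_glue_oriented G h k"
    note r = cut_glue_rep(1)[OF hk(2-5) v(1)]
    have "p \<in> edges (graph_of ?G)" "q \<in> edges (graph_of ?G)"
      unfolding r edges_cut_glue[OF X hk(2-5)] qk hk(1) by auto
    moreover have "\<not> is_loop (graph_of ?G) q" unfolding r is_loop_cut_glue by (rule nl(1))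
    moreover have "\<not> is_loop (collapse (graph_of ?G) q) p"
      unfolding r collapse_cut_glue is_loop_cut_glue by (rule nl(4))
    ultimately have o: "opposite_oriented (collapse_edge (collapse_edge ?G p) q) (collapse_edge (collapse_edge ?G q) p)"
      by (intro collapse_edge_commute)
    have "pinch G p = collapse_edge ?G p" unfolding hk(1) by (rule pinch_pair[OF hk(2-5) v(1)])
    moreover have "pinch G q = collapse_edge (cut_glue_oriented G (bar ?X k) (bar ?X h)) q"
      unfolding qk by (rule pinch_pair) (use hk G(4,6) D v in auto)
    moreover have "cut_glue_oriented G (bar ?X k) (bar ?X h) = ?G"
      unfolding cut_glue_oriented_def cut_glue_bar_bar[OF X hk(2-5) rep_valid(2)] ..
    ultimately have "opposite_oriented (collapse_edge (pinch G p) q) (collapse_edge (pinch G q) p)"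
      using o by simp
    then have "(gc_class (collapse_edge (pinch G p) q) :: 'k graph_complex) =
        - gc_class (collapse_edge (pinch G q) p)" by (rule gc_class_opp)
    then show ?thesis using False nl by (simp add: collapse_class_def)
  qed
qed

subsection \<open>Cancellation\<close>

lemma boundary_E_gc_class: "boundary_E (gc_class G) = (\<Sum>e\<in>edges (graph_of G). collapse_class G e)"
  unfolding boundary_E_class collapse_class_def ..

lemma boundary_H_gc_class: "boundary_H (gc_class G) = (\<Sum>p\<in>half_edge_pairs (graph_of G). pinch_class G p)"
  unfolding gc_class.abs_eq boundary_H.abs_eq linear_extension_single boundary_H_gen_def abs_gc_sum
proof (intro sum.cong refl)
  fix p assume "p \<in> half_edge_pairs (graph_of G)"
  then obtain h k where hk: "p = {h, k}" "Min p = h" "Max p = k"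
    using half_edge_pairs_sortedE[OF rep_valid(1)] by metis
  have "is_loop (graph_of G) p \<longleftrightarrow> vert (graph_of G) (Min p) = vert (graph_of G) (Max p)"
    "{Min p, Max p} = p"
    unfolding hk(2,3) using hk(1) is_loop_iff by simp_all
  then show "abs_graph_complex (pinch_term G (Min p) (Max p)) = pinch_class G p"
    by (auto simp: pinch_term_def pinch_class_def pinch_def abs_gc_zero gc_class.abs_eq)
qed

interpretation boundary_E: Vector_Spaces.linear gc_scale gc_scale boundary_E
  by (rule linear_boundary_E)

interpretation boundary_H: Vector_Spaces.linear gc_scale gc_scale boundary_H
  by (rule linear_boundary_H)

text \<open>In characteristic zero the scalar 2 is invertible.\<close>

lemma gc_self_opposite:
  fixes x :: "'k::field_char_0 graph_complex"
  assumes "x = - x" shows "x = 0"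
proof -
  have "gc_scale (2 :: 'k) x = 0"
    using assms by (metis gc.scale_left_distrib gc.scale_one one_add_one add.right_inverse)
  then show ?thesis by simp
qed

lemma gc_class_expansion:
  fixes x :: "'k::field_char_0 graph_complex"
  obtains S and c :: "oriented_graph \<Rightarrow> 'k" where "x = (\<Sum>G\<in>S. gc_scale (c G) (gc_class G))"
proof -
  have "\<exists>b. x = abs_graph_complex b" by (induct x rule: graph_complex.abs_induct) blast
  then obtain b where b: "x = abs_graph_complex b" ..
  let ?S = "Poly_Mapping.keys b"
  have "b = (\<Sum>G\<in>?S. chain_scale (Poly_Mapping.lookup b G) (Poly_Mapping.single G 1))"
    by (rule poly_mapping_eqI) (simp add: lookup_sum lookup_single when_def in_keys_iff if_distrib cong: if_cong)
  then have "x = (\<Sum>G\<in>?S. abs_graph_complex (chain_scale (Poly_Mapping.lookup b G) (Poly_Mapping.single G 1)))"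
    unfolding b abs_gc_sum[symmetric] by simp
  then have "x = (\<Sum>G\<in>?S. gc_scale (Poly_Mapping.lookup b G) (gc_class G))"
    by (simp add: gc_class.abs_eq gc_scale.abs_eq)
  then show thesis using that by blast
qed

lemma anticommute_gc_class:
  "boundary_E (boundary_H (gc_class G :: 'k::field_char_0 graph_complex)) = - boundary_H (boundary_E (gc_class G))"
proof -
  let ?X = "graph_of G" and ?P = "half_edge_pairs (graph_of G)" and ?E = "edges (graph_of G)"
  note X = rep_valid(1)[of G]
  \<comment> \<open>The vanishing terms are built into \<open>t\<close> and \<open>s\<close>, so the
    index sets of the double sums need no loop conditions.\<close>
  define t :: "nat set \<Rightarrow> nat set \<Rightarrow> 'k graph_complex" where
    "t p e = (if is_loop ?X p then 0 else collapse_class (pinch G p) e)" for p e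
  define s :: "nat set \<Rightarrow> nat set \<Rightarrow> 'k graph_complex" where
    "s e p = (if is_loop ?X e then 0 else pinch_class (collapse_edge G e) p)" for e p
  have "?E \<subseteq> Pow (halves ?X)" "?P \<subseteq> Pow (halves ?X)"
    using edges_halves[OF X] by (auto simp: half_edge_pairs_def)
  then have fin: "finite ?E" "finite ?P" using graphD(2)[OF X] finite_subset by blast+
  have EH: "boundary_E (pinch_class G p) = (\<Sum>e | e \<in> ?E \<and> e \<inter> p = {}. t p e) + t p (bar ?X ` p)"
    if p: "p \<in> ?P" for p
  proof (cases "is_loop ?X p")
    case False
    then have "boundary_E (pinch_class G p) = (\<Sum>e\<in>edges (graph_of (pinch G p)). t p e)"
      by (simp add: pinch_class_def t_def boundary_E_gc_class)
    then show ?thesis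
      unfolding pinch_edges(1)[OF p False] using fin pinch_edges(2)[OF p False] by (simp add: add.commute)
  qed (simp add: pinch_class_def t_def boundary_E.zero)
  have HE: "boundary_H (collapse_class G e) = (\<Sum>p | p \<in> ?P \<and> e \<inter> p = {}. s e p)" if e: "e \<in> ?E" for e
  proof (cases "is_loop ?X e")
    case False
    then show ?thesis
      by (simp add: collapse_class_def s_def boundary_H_gc_class collapse_edge_rep(1)[OF e False]
          half_edge_pairs_collapse[OF X e])
  qed (simp add: collapse_class_def s_def boundary_H.zero)
  \<comment> \<open>The contribution of the new edges. Reindexing along the involution that
    \<open>bar\<close> induces on pairs turns \<open>r\<close> into \<open>- r\<close>, which avoids
    choosing one pair out of each two complementary ones.\<close>
  define r where "r = (\<Sum>p\<in>?P. t p (bar ?X ` p))"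
  have "r = (\<Sum>p\<in>?P. t (bar ?X ` p) p)"
    unfolding r_def by (rule sum.reindex_bij_witness[of _ "(`) (bar ?X)" "(`) (bar ?X)"])
      (use bar_image_pair[OF X] in auto)
  also have "\<dots> = (\<Sum>p\<in>?P. - t p (bar ?X ` p))"
    unfolding t_def by (intro sum.cong refl collapse_bar_pinch_class)
  also have "\<dots> = - r" unfolding r_def by (rule sum_negf)
  finally have r: "r = 0" by (rule gc_self_opposite)
  have "boundary_E (boundary_H (gc_class G)) =
      (\<Sum>p\<in>?P. (\<Sum>e | e \<in> ?E \<and> e \<inter> p = {}. t p e) + t p (bar ?X ` p))"
    unfolding boundary_H_gc_class boundary_E.sum by (intro sum.cong refl EH)
  also have "\<dots> = (\<Sum>p\<in>?P. \<Sum>e | e \<in> ?E \<and> e \<inter> p = {}. t p e)"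
    using r by (simp add: sum.distrib r_def)
  also have "\<dots> = (\<Sum>p\<in>?P. \<Sum>e | e \<in> ?E \<and> e \<inter> p = {}. - s e p)"
    unfolding t_def s_def by (intro sum.cong refl collapse_pinch_class) auto
  also have "\<dots> = (\<Sum>e\<in>?E. \<Sum>p | p \<in> ?P \<and> e \<inter> p = {}. - s e p)"
    using fin(2,1) by (rule sum.swap_restrict)
  also have "\<dots> = - (\<Sum>e\<in>?E. \<Sum>p | p \<in> ?P \<and> e \<inter> p = {}. s e p)" by (simp add: sum_negf)
  also have "\<dots> = - boundary_H (boundary_E (gc_class G))"
    unfolding boundary_E_gc_class boundary_H.sum by (simp add: HE)
  finally show ?thesis .
qed

theorem corollary2p6:
  fixes x :: "'k::field_char_0 graph_complex"
  shows "boundary_E (boundary_H x) = - boundary_H (boundary_E x)"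
proof -
  obtain S and c :: "oriented_graph \<Rightarrow> 'k" where x: "x = (\<Sum>G\<in>S. gc_scale (c G) (gc_class G))"
    by (rule gc_class_expansion)
  show ?thesis
    unfolding x by (simp add: boundary_E.sum boundary_H.sum boundary_E.scale boundary_H.scale anticommute_gc_class gc.scale_minus_right sum_negf)
qed

end
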